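(* Let $r\ge 1$ and let $q$ and $\tilde q$ be weakly Gram congruent connected non-negative unit forms of Dynkin type $\mathbb{A}_r$. Then $q$ and $\tilde q$ are strongly Gram congruent if and only if they have the same Coxeter polynomial.
   Context: An integral quadratic form $q:\mathbb{Z}^n\to\mathbb{Z}$, $q(x)=\sum_{i\le j}q_{ij}x_ix_j$, is a unit form if $q(\mathbf{e}_i)=1$ for all $i$; non-negative if $q(x)\ge0$ for all $x$; connected if the graph on $\{1,\dots,n\}$ with an edge $i$–$j$ whenever $q_{ij}\ne 0$ ($i<j$) is connected. $G_q$ is the symmetric Gram matrix of the polarization $\mathbb{b}_q(x,y)=q(x+y)-q(x)-q(y)$, and $\check{G}_q$ is the unique upper triangular integer matrix with $q(x)=x^{\mathrm{tr}}\check{G}_qx$. Two unit forms $q,q'$ are weakly Gram congruent if $G_{q'}=B^{\mathrm{tr}}G_qB$ for a $\mathbb{Z}$-invertible $B$, and strongly Gram congruent if $\check{G}_{q'}=B^{\mathrm{tr}}\check{G}_qB$ for a $\mathbb{Z}$-invertible $B$. The Coxeter matrix of a unit form $q$ is $\Phi_q=-\check{G}_q^{\mathrm{tr}}\check{G}_q^{-1}$ and its characteristic polynomial is the Coxeter polynomial $\varphi_q$ of $q$. The Dynkin type of a connected non-negative unit form $q$ is the unique simply-laced Dynkin diagram $\Delta$ such that the form induced by $q$ on $\mathbb{Z}^n/\ker G_q$ is equivalent to $q_\Delta$, where $G_{q_\Delta}=2\mathrm{Id}-\mathrm{Adj}(\Delta)$. *)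

theory Defs
  imports
    "HOL-Algebra.Coset"
    "Jordan_Normal_Form.Char_Poly"
    "Jordan_Normal_Form.Matrix_Kernel"
begin

text \<open>
  Forms on \<open>\<int>\<^sup>n\<close> are functions on integer vectors, of which only the values on
  \<^term>\<open>carrier_vec n\<close> matter; the indices \<open>1, \<dots>, n\<close> become \<open>0, \<dots>, n - 1\<close>.
\<close>

definition integral_quadratic_form :: "nat \<Rightarrow> (int vec \<Rightarrow> int) \<Rightarrow> bool" where
  "integral_quadratic_form n q \<longleftrightarrow>
     (\<exists>c :: nat \<Rightarrow> nat \<Rightarrow> int. \<forall>x \<in> carrier_vec n.
        q x = (\<Sum>j<n. \<Sum>i\<le>j. c i j * (x $ i * x $ j)))"

definition unit_form :: "nat \<Rightarrow> (int vec \<Rightarrow> int) \<Rightarrow> bool" where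
  "unit_form n q \<longleftrightarrow> integral_quadratic_form n q \<and> (\<forall>i<n. q (unit_vec n i) = 1)"

definition nonneg_form :: "nat \<Rightarrow> (int vec \<Rightarrow> int) \<Rightarrow> bool" where
  "nonneg_form n q \<longleftrightarrow> (\<forall>x \<in> carrier_vec n. 0 \<le> q x)"

definition polarization :: "(int vec \<Rightarrow> int) \<Rightarrow> int vec \<Rightarrow> int vec \<Rightarrow> int" where
  "polarization q x y = q (x + y) - q x - q y"

definition gram_mat :: "nat \<Rightarrow> (int vec \<Rightarrow> int) \<Rightarrow> int mat" where
  "gram_mat n q = mat n n (\<lambda>(i, j). polarization q (unit_vec n i) (unit_vec n j))"

definition upper_gram_mat :: "nat \<Rightarrow> (int vec \<Rightarrow> int) \<Rightarrow> int mat" where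
  "upper_gram_mat n q =
     (THE G. G \<in> carrier_mat n n \<and> upper_triangular G \<and>
        (\<forall>x \<in> carrier_vec n. q x = x \<bullet> (G *\<^sub>v x)))"

text \<open>
  The coefficient \<open>q\<^sub>i\<^sub>j\<close> (\<open>i \<le> j\<close>) is the entry of the upper triangular Gram matrix at \<open>(i, j)\<close>.
\<close>

definition form_edges :: "nat \<Rightarrow> (int vec \<Rightarrow> int) \<Rightarrow> (nat \<times> nat) set" where
  "form_edges n q = {(i, j). i < j \<and> j < n \<and> upper_gram_mat n q $$ (i, j) \<noteq> 0}"

definition connected_form :: "nat \<Rightarrow> (int vec \<Rightarrow> int) \<Rightarrow> bool" where
  "connected_form n q \<longleftrightarrow>
     (\<forall>i<n. \<forall>j<n. (i, j) \<in> (form_edges n q \<union> (form_edges n q)\<inverse>)\<^sup>*)"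

definition weakly_gram_congruent :: "nat \<Rightarrow> (int vec \<Rightarrow> int) \<Rightarrow> (int vec \<Rightarrow> int) \<Rightarrow> bool" where
  "weakly_gram_congruent n q q' \<longleftrightarrow>
     (\<exists>B \<in> carrier_mat n n. invertible_mat B \<and>
        gram_mat n q' = transpose_mat B * gram_mat n q * B)"

definition strongly_gram_congruent :: "nat \<Rightarrow> (int vec \<Rightarrow> int) \<Rightarrow> (int vec \<Rightarrow> int) \<Rightarrow> bool" where
  "strongly_gram_congruent n q q' \<longleftrightarrow>
     (\<exists>B \<in> carrier_mat n n. invertible_mat B \<and>
        upper_gram_mat n q' = transpose_mat B * upper_gram_mat n q * B)"

text \<open>
  The inverse is taken over the integers; for a unit form the upper triangular Gram matrix
  has determinant 1, so nothing is lost compared to the rational inverse.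
\<close>

definition int_mat_inverse :: "int mat \<Rightarrow> int mat" where
  "int_mat_inverse A = (THE B. inverts_mat A B \<and> inverts_mat B A)"

definition coxeter_mat :: "nat \<Rightarrow> (int vec \<Rightarrow> int) \<Rightarrow> int mat" where
  "coxeter_mat n q =
     - (transpose_mat (upper_gram_mat n q) * int_mat_inverse (upper_gram_mat n q))"

definition coxeter_poly :: "nat \<Rightarrow> (int vec \<Rightarrow> int) \<Rightarrow> int poly" where
  "coxeter_poly n q = char_poly (coxeter_mat n q)"

datatype simply_laced = Dyn_A nat | Dyn_D nat | Dyn_E nat

fun is_dynkin :: "simply_laced \<Rightarrow> bool" where
  "is_dynkin (Dyn_A r) \<longleftrightarrow> r \<ge> 1"
| "is_dynkin (Dyn_D r) \<longleftrightarrow> r \<ge> 4"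
| "is_dynkin (Dyn_E r) \<longleftrightarrow> r \<in> {6, 7, 8}"

fun dynkin_rank :: "simply_laced \<Rightarrow> nat" where
  "dynkin_rank (Dyn_A r) = r"
| "dynkin_rank (Dyn_D r) = r"
| "dynkin_rank (Dyn_E r) = r"

text \<open>
  Edges \<open>(i, j)\<close> are listed with \<open>i < j\<close>. The diagrams of type D and E consist of
  a path on \<open>0, \<dots>, r - 2\<close> and one further vertex \<open>r - 1\<close>, attached to the penultimate
  vertex \<open>r - 3\<close> of the path for D, and to the third vertex \<open>2\<close> for E.
\<close>

fun dynkin_edges :: "simply_laced \<Rightarrow> (nat \<times> nat) set" where
  "dynkin_edges (Dyn_A r) = {(i, Suc i) | i. Suc i < r}"
| "dynkin_edges (Dyn_D r) = {(i, Suc i) | i. Suc i < r - 1} \<union> {(r - 3, r - 1)}"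
| "dynkin_edges (Dyn_E r) = {(i, Suc i) | i. Suc i < r - 1} \<union> {(2, r - 1)}"

definition dynkin_adj :: "simply_laced \<Rightarrow> int mat" where
  "dynkin_adj \<Delta> = mat (dynkin_rank \<Delta>) (dynkin_rank \<Delta>)
     (\<lambda>(i, j). if (i, j) \<in> dynkin_edges \<Delta> \<or> (j, i) \<in> dynkin_edges \<Delta> then 1 else 0)"

text \<open>
  As the polarization of \<open>q\<close> takes the value \<open>2 q(x)\<close> at \<open>(x, x)\<close>, the form with Gram matrix
  \<open>G = 2 Id - Adj(\<Delta>)\<close> is \<open>q(x) = x\<^sup>t\<^sup>r G x / 2\<close>; the division is exact because \<open>G\<close> is symmetric
  with even diagonal. See \<open>gram_mat_dynkin_form\<close> below.
\<close>

definition dynkin_form :: "simply_laced \<Rightarrow> int vec \<Rightarrow> int" where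
  "dynkin_form \<Delta> x = (x \<bullet> ((2 \<cdot>\<^sub>m 1\<^sub>m (dynkin_rank \<Delta>) - dynkin_adj \<Delta>) *\<^sub>v x)) div 2"

definition radical_quotient :: "nat \<Rightarrow> (int vec \<Rightarrow> int) \<Rightarrow> int vec set monoid" where
  "radical_quotient n q = monoid_vec TYPE(int) n Mod mat_kernel (gram_mat n q)"

definition induced_form :: "(int vec \<Rightarrow> int) \<Rightarrow> int vec set \<Rightarrow> int" where
  "induced_form q C = (THE v. \<forall>x \<in> C. q x = v)"

definition has_dynkin_type :: "nat \<Rightarrow> (int vec \<Rightarrow> int) \<Rightarrow> simply_laced \<Rightarrow> bool" where
  "has_dynkin_type n q \<Delta> \<longleftrightarrow> is_dynkin \<Delta> \<and>
     (\<exists>h \<in> iso (radical_quotient n q) (monoid_vec TYPE(int) (dynkin_rank \<Delta>)).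
        \<forall>C \<in> carrier (radical_quotient n q). dynkin_form \<Delta> (h C) = induced_form q C)"

lemma quad_mat_expand:
  fixes G :: "int mat"
  assumes "G \<in> carrier_mat n n" "x \<in> carrier_vec n" "y \<in> carrier_vec n"
  shows "x \<bullet> (G *\<^sub>v y) = (\<Sum>i<n. \<Sum>j<n. G $$ (i, j) * (x $ i * y $ j))"
  using assms
  by (auto simp: scalar_prod_def lessThan_atLeast0 sum_distrib_left algebra_simps intro!: sum.cong)

lemma quad_mat_transpose:
  fixes G :: "int mat"
  assumes "G \<in> carrier_mat n n" "x \<in> carrier_vec n" "y \<in> carrier_vec n"
  shows "y \<bullet> (G *\<^sub>v x) = x \<bullet> (transpose_mat G *\<^sub>v y)"
  using assms
  by (simp add: quad_mat_expand[of _ n], subst sum.swap) (simp add: mult.commute)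

lemma polarization_quad_mat:
  fixes G :: "int mat"
  assumes G: "G \<in> carrier_mat n n" and q: "\<forall>x \<in> carrier_vec n. q x = x \<bullet> (G *\<^sub>v x)"
    and xy: "x \<in> carrier_vec n" "y \<in> carrier_vec n"
  shows "polarization q x y = x \<bullet> ((G + transpose_mat G) *\<^sub>v y)"
proof -
  have "q (x + y) = (x + y) \<bullet> (G *\<^sub>v (x + y))"
    using q xy by auto
  also have "\<dots> = x \<bullet> (G *\<^sub>v x) + y \<bullet> (G *\<^sub>v y) + (x \<bullet> (G *\<^sub>v y) + y \<bullet> (G *\<^sub>v x))"
    using G xy
    by (simp add: mult_add_distrib_mat_vec[of _ n n] add_scalar_prod_distrib[of _ n]
        scalar_prod_add_distrib[of _ n])
  also have "y \<bullet> (G *\<^sub>v x) = x \<bullet> (transpose_mat G *\<^sub>v y)"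
    using quad_mat_transpose[OF G xy] .
  finally show ?thesis
    using G q xy
    by (simp add: polarization_def add_mult_distrib_mat_vec[of _ n n] scalar_prod_add_distrib[of _ n])
qed

lemma gram_mat_quad_mat:
  fixes G :: "int mat"
  assumes G: "G \<in> carrier_mat n n" and q: "\<forall>x \<in> carrier_vec n. q x = x \<bullet> (G *\<^sub>v x)"
  shows "gram_mat n q = G + transpose_mat G"
proof (rule eq_matI)
  fix i j assume "i < dim_row (G + transpose_mat G)" "j < dim_col (G + transpose_mat G)"
  then have ij: "i < n" "j < n" using G by auto
  have "polarization q (unit_vec n i) (unit_vec n j)
      = unit_vec n i \<bullet> ((G + transpose_mat G) *\<^sub>v unit_vec n j)"
    by (rule polarization_quad_mat[OF G q]) auto
  also have "\<dots> = (G + transpose_mat G) $$ (i, j)"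
    using G ij by (subst scalar_prod_left_unit[of _ n])
        (auto intro!: mult_mat_vec_carrier[of _ n n])
  finally show "gram_mat n q $$ (i, j) = (G + transpose_mat G) $$ (i, j)"
    using ij by (simp add: gram_mat_def)
qed (use G in \<open>auto simp: gram_mat_def\<close>)

lemma upper_gram_mat_unique:
  assumes "integral_quadratic_form n q"
  shows "\<exists>!G. G \<in> carrier_mat n n \<and> upper_triangular G \<and>
           (\<forall>x \<in> carrier_vec n. q x = x \<bullet> (G *\<^sub>v x))"
proof (rule ex_ex1I)
  obtain c :: "nat \<Rightarrow> nat \<Rightarrow> int" where
    c: "\<forall>x \<in> carrier_vec n. q x = (\<Sum>j<n. \<Sum>i\<le>j. c i j * (x $ i * x $ j))"
    using assms unfolding integral_quadratic_form_def by blast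
  define G where "G = mat n n (\<lambda>(i, j). if i \<le> j then c i j else 0)"
  have "q x = x \<bullet> (G *\<^sub>v x)" if x: "x \<in> carrier_vec n" for x
  proof -
    have "x \<bullet> (G *\<^sub>v x) = (\<Sum>j<n. \<Sum>i<n. G $$ (i, j) * (x $ i * x $ j))"
      by (subst sum.swap, rule quad_mat_expand) (auto simp: G_def x)
    also have "\<dots> = (\<Sum>j<n. \<Sum>i\<le>j. c i j * (x $ i * x $ j))"
      by (intro sum.cong refl sum.mono_neutral_cong_right) (auto simp: G_def)
    finally show ?thesis using c x by simp
  qed
  moreover have "G \<in> carrier_mat n n" "upper_triangular G"
    by (auto simp: G_def)
  ultimately show "\<exists>G. G \<in> carrier_mat n n \<and> upper_triangular G \<and>
           (\<forall>x \<in> carrier_vec n. q x = x \<bullet> (G *\<^sub>v x))" by blast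
next
  fix G H :: "int mat"
  assume G: "G \<in> carrier_mat n n \<and> upper_triangular G \<and> (\<forall>x \<in> carrier_vec n. q x = x \<bullet> (G *\<^sub>v x))"
    and H: "H \<in> carrier_mat n n \<and> upper_triangular H \<and> (\<forall>x \<in> carrier_vec n. q x = x \<bullet> (H *\<^sub>v x))"
  have eq: "G + transpose_mat G = H + transpose_mat H"
    using gram_mat_quad_mat[of G n q] gram_mat_quad_mat[of H n q] G H by metis
  show "G = H"
  proof (rule eq_matI)
    fix i j assume "i < dim_row H" "j < dim_col H"
    then have ij: "i < n" "j < n" using H by auto
    have "(G + transpose_mat G) $$ (i, j) = (H + transpose_mat H) $$ (i, j)"
      using eq by simp
    then have *: "G $$ (i, j) + G $$ (j, i) = H $$ (i, j) + H $$ (j, i)"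
      using G H ij by auto
    have z: "G $$ (k, l) = 0" "H $$ (k, l) = 0" if "l < k" "k < n" for k l
      using G H that unfolding upper_triangular_def by auto
    show "G $$ (i, j) = H $$ (i, j)"
      using * z[of i j] z[of j i] ij by (cases i j rule: linorder_cases) auto
  qed (use G H in auto)
qed

lemma upper_gram_mat:
  assumes "integral_quadratic_form n q"
  shows "upper_gram_mat n q \<in> carrier_mat n n" "upper_triangular (upper_gram_mat n q)"
    and "x \<in> carrier_vec n \<Longrightarrow> q x = x \<bullet> (upper_gram_mat n q *\<^sub>v x)"
  using theI'[OF upper_gram_mat_unique[OF assms]] unfolding upper_gram_mat_def by blast+

lemma det_upper_gram_mat:
  assumes "unit_form n q"
  shows "det (upper_gram_mat n q) = 1"
proof -
  let ?G = "upper_gram_mat n q"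
  have iq: "integral_quadratic_form n q" using assms by (simp add: unit_form_def)
  have "?G $$ (i, i) = 1" if i: "i < n" for i
  proof -
    have "1 = unit_vec n i \<bullet> (?G *\<^sub>v unit_vec n i)"
      using assms i upper_gram_mat(3)[OF iq, of "unit_vec n i"] by (simp add: unit_form_def)
    also have "\<dots> = ?G $$ (i, i)"
      using upper_gram_mat(1)[OF iq] i by (subst scalar_prod_left_unit[of _ n])
        (auto intro!: mult_mat_vec_carrier[of _ n n])
    finally show ?thesis by simp
  qed
  then show ?thesis
    using upper_gram_mat(1,2)[OF iq]
    by (subst det_upper_triangular[of _ n]) (auto simp: diag_mat_def intro!: prod_list_neutral)
qed

lemma int_mat_inverse:
  assumes A: "A \<in> carrier_mat n n" and det: "det A = 1"
  shows "int_mat_inverse A \<in> carrier_mat n n"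
    and "A * int_mat_inverse A = 1\<^sub>m n" and "int_mat_inverse A * A = 1\<^sub>m n"
proof -
  have dims: "B \<in> carrier_mat n n" if "inverts_mat A B \<and> inverts_mat B A" for B
  proof -
    have "A * B = 1\<^sub>m n" "B * A = 1\<^sub>m (dim_row B)" using that A by (auto simp: inverts_mat_def)
    then have "dim_col (A * B) = n" "dim_col (B * A) = dim_row B" by auto
    then show ?thesis using A by auto
  qed
  have "\<exists>!B. inverts_mat A B \<and> inverts_mat B A"
  proof (rule ex_ex1I)
    show "\<exists>B. inverts_mat A B \<and> inverts_mat B A"
      using adj_mat[OF A] A det
      by (intro exI[of _ "adj_mat A"]) (auto simp: inverts_mat_def)
  next
    fix B C assume B: "inverts_mat A B \<and> inverts_mat B A" and C: "inverts_mat A C \<and> inverts_mat C A"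
    have "B = B * (A * C)" using C A dims[OF B] by (simp add: inverts_mat_def)
    also have "\<dots> = (B * A) * C" using A dims[OF B] dims[OF C] by simp
    also have "\<dots> = C" using B dims[OF B] dims[OF C] by (simp add: inverts_mat_def)
    finally show "B = C" .
  qed
  from theI'[OF this] have I: "inverts_mat A (int_mat_inverse A) \<and> inverts_mat (int_mat_inverse A) A"
    unfolding int_mat_inverse_def .
  show "int_mat_inverse A \<in> carrier_mat n n" using dims[OF I] .
  then show "A * int_mat_inverse A = 1\<^sub>m n" "int_mat_inverse A * A = 1\<^sub>m n"
    using I A by (auto simp: inverts_mat_def)
qed

lemma induced_form_rcoset:
  assumes iq: "integral_quadratic_form n q" and x: "x \<in> carrier_vec n"
  shows "induced_form q (mat_kernel (gram_mat n q) #>\<^bsub>monoid_vec TYPE(int) n\<^esub> x) = q x"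
proof -
  let ?K = "mat_kernel (gram_mat n q)" and ?G = "upper_gram_mat n q"
  note G = upper_gram_mat(1)[OF iq]
  have GG: "gram_mat n q = ?G + transpose_mat ?G"
    by (rule gram_mat_quad_mat) (use upper_gram_mat[OF iq] in auto)
  have K: "k \<in> carrier_vec n" "gram_mat n q *\<^sub>v k = 0\<^sub>v n" if "k \<in> ?K" for k
    using that by (auto simp: mat_kernel_def gram_mat_def)
  have pol: "polarization q y k = 0" if "k \<in> ?K" "y \<in> carrier_vec n" for y k
    using polarization_quad_mat[OF G _ that(2) K(1)[OF that(1)], of q] upper_gram_mat(3)[OF iq]
      K[OF that(1)] that(2) by (simp add: GG)
  have qk: "q k = 0" if k: "k \<in> ?K" for k
  proof -
    have kc: "k \<in> carrier_vec n" using K[OF k] by simp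
    have "k \<bullet> (?G *\<^sub>v k) = k \<bullet> (transpose_mat ?G *\<^sub>v k)"
      using quad_mat_transpose[OF G kc kc] .
    moreover have "polarization q k k = k \<bullet> (?G *\<^sub>v k) + k \<bullet> (transpose_mat ?G *\<^sub>v k)"
      using polarization_quad_mat[OF G _ kc kc, of q] upper_gram_mat(3)[OF iq] G kc
      by (simp add: add_mult_distrib_mat_vec[of _ n n] scalar_prod_add_distrib[of _ n])
    ultimately show ?thesis using pol[OF k kc] upper_gram_mat(3)[OF iq kc] by simp
  qed
  have val: "q (k + x) = q x" if "k \<in> ?K" for k
    using pol[OF that x] qk[OF that] K(1)[OF that] x
    by (simp add: polarization_def comm_add_vec[of k n x])
  have "0\<^sub>v n \<in> ?K"
    by (auto simp: mat_kernel_def gram_mat_def)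
  then have mem: "x \<in> ?K #>\<^bsub>monoid_vec TYPE(int) n\<^esub> x"
    using x by (force simp: r_coset_def monoid_vec_def)
  show ?thesis
    unfolding induced_form_def
    by (rule the_equality) (use mem val in \<open>auto simp: r_coset_def monoid_vec_def\<close>)
qed

lemma dynkin_edges_less: "is_dynkin \<Delta> \<Longrightarrow> (i, j) \<in> dynkin_edges \<Delta> \<Longrightarrow> i < j \<and> j < dynkin_rank \<Delta>"
  by (cases \<Delta>) auto

lemma gram_mat_dynkin_form:
  assumes \<Delta>: "is_dynkin \<Delta>"
  shows "gram_mat (dynkin_rank \<Delta>) (dynkin_form \<Delta>) = 2 \<cdot>\<^sub>m 1\<^sub>m (dynkin_rank \<Delta>) - dynkin_adj \<Delta>"
proof -
  let ?n = "dynkin_rank \<Delta>"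
  let ?S = "2 \<cdot>\<^sub>m 1\<^sub>m ?n - dynkin_adj \<Delta>"
  define G :: "int mat" where
    "G = mat ?n ?n (\<lambda>(i, j). if i = j then 1 else if (i, j) \<in> dynkin_edges \<Delta> then - 1 else 0)"
  have G: "G \<in> carrier_mat ?n ?n" by (simp add: G_def)
  have S: "?S = G + transpose_mat G"
    by (rule eq_matI) (use dynkin_edges_less[OF \<Delta>] in \<open>auto simp: G_def dynkin_adj_def, fastforce+\<close>)
  have "dynkin_form \<Delta> x = x \<bullet> (G *\<^sub>v x)" if x: "x \<in> carrier_vec ?n" for x
  proof -
    have "x \<bullet> (G *\<^sub>v x) = x \<bullet> (transpose_mat G *\<^sub>v x)"
      using quad_mat_transpose[OF G x x] .
    then have "x \<bullet> (?S *\<^sub>v x) = 2 * (x \<bullet> (G *\<^sub>v x))"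
      unfolding S using G x
      by (simp add: add_mult_distrib_mat_vec[of _ ?n ?n] scalar_prod_add_distrib[of _ ?n])
    then show ?thesis by (simp add: dynkin_form_def)
  qed
  then show ?thesis
    unfolding S by (intro gram_mat_quad_mat[OF G]) auto
qed

end

theory Submission
  imports Defs "Jordan_Normal_Form.Schur_Decomposition"
begin

text \<open>
  A form of Dynkin type \<open>A\<^sub>r\<close> is the pullback of the root lattice \<open>A\<^sub>r \<subset> \<int>\<^sup>r\<^sup>+\<^sup>1\<close> along a surjection, so
  each unit vector is mapped to a root \<open>e\<^sub>s - e\<^sub>t\<close>. The form is thus encoded by a list of \<open>n\<close> arcs
  \<open>(s, t)\<close> on \<open>r + 1\<close> vertices, and surjectivity means that this quiver is connected. Let \<open>\<sigma>\<close> be the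
  product of the transpositions \<open>(s t)\<close> in the order of the list, and \<open>V\<close> the matrix with the roots as
  columns. From \<open>\<Phi> = 1 - V\<^sup>T (V G\<^sup>-\<^sup>1)\<close> and \<open>P\<^sub>\<sigma> = 1 - (V G\<^sup>-\<^sup>1) V\<^sup>T\<close>, where \<open>G\<close> is the upper triangular
  Gram matrix, Sylvester's determinant identity shows that the Coxeter polynomial and the
  characteristic polynomial of the permutation matrix \<open>P\<^sub>\<sigma>\<close> agree up to a power of \<open>x - 1\<close>. Hence the
  Coxeter polynomial determines the cycle type of \<open>\<sigma>\<close>; after renaming vertices, which does not
  change \<open>G\<close>, two forms with the same Coxeter polynomial have the same \<open>\<sigma>\<close>. Connected factorizations of
  \<open>\<sigma>\<close> into \<open>n\<close> transpositions form a single orbit under Hurwitz moves, and every Hurwitz move is a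
  strong Gram congruence.
\<close>

subsection \<open>Hurwitz moves on lists of arcs\<close>

text \<open>The last arc of the list acts first. Reversing an arc changes neither its transposition
  nor the product.\<close>

fun arc_prod :: "('a \<times> 'a) list \<Rightarrow> 'a \<Rightarrow> 'a" where
  "arc_prod [] = id"
| "arc_prod ((a, b) # ts) = transpose a b \<circ> arc_prod ts"

definition arcs :: "'a set \<Rightarrow> ('a \<times> 'a) set" where
  "arcs A = {(a, b). a \<in> A \<and> b \<in> A \<and> a \<noteq> b}"

text \<open>Phrased through closed vertex sets rather than paths: a form yields it by summing
  coordinates over \<open>C\<close>, and in proofs it acts as an induction principle over the
  vertices.\<close>

definition arcs_connected :: "'a set \<Rightarrow> ('a \<times> 'a) list \<Rightarrow> bool" where
  "arcs_connected A ts \<longleftrightarrow>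
     (\<forall>C \<subseteq> A. (\<forall>(a, b) \<in> set ts. a \<in> C \<longleftrightarrow> b \<in> C) \<longrightarrow> C = {} \<or> C = A)"

text \<open>For a proper arc \<open>p\<close> this is conjugation by \<open>p\<close> on
  transpositions, and on roots the reflection in the hyperplane orthogonal to the root of
  \<open>p\<close>.\<close>

definition reflect_arc :: "'a \<times> 'a \<Rightarrow> 'a \<times> 'a \<Rightarrow> 'a \<times> 'a" where
  "reflect_arc p t =
     (transpose (fst p) (snd p) (fst t), transpose (fst p) (snd p) (snd t))"

text \<open>Besides the braid move there is a flip, because an arc and its reverse are the same
  transposition while their roots differ by a sign. Symmetry of the relation supplies the inverse
  braid moves.\<close>

inductive hurwitz_eq :: "('a \<times> 'a) list \<Rightarrow> ('a \<times> 'a) list \<Rightarrow> bool" (infix "\<simeq>" 50) where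
  hurwitz_refl: "ts \<simeq> ts"
| hurwitz_sym: "ts \<simeq> us \<Longrightarrow> us \<simeq> ts"
| hurwitz_trans [trans]: "ts \<simeq> us \<Longrightarrow> us \<simeq> ws \<Longrightarrow> ts \<simeq> ws"
| hurwitz_flip: "xs @ (a, b) # ys \<simeq> xs @ (b, a) # ys"
| hurwitz_move: "xs @ p # t # ys \<simeq> xs @ reflect_arc p t # p # ys"

lemma reflect_arc_reflect_arc [simp]: "reflect_arc p (reflect_arc p t) = t"
  by (simp add: reflect_arc_def)

lemma hurwitz_eq_context:
  assumes "ts \<simeq> us"
  shows "xs @ ts @ ys \<simeq> xs @ us @ ys"
  using assms
proof induction
  case (hurwitz_flip us a b ws)
  show ?case using hurwitz_eq.hurwitz_flip[of "xs @ us" a b "ws @ ys"] by simp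
next
  case (hurwitz_move us p t ws)
  show ?case using hurwitz_eq.hurwitz_move[of "xs @ us" p t "ws @ ys"] by simp
next
  case (hurwitz_trans ts us ws)
  show ?case by (rule hurwitz_eq.hurwitz_trans) fact+
next
  case (hurwitz_sym ts us)
  show ?case by (rule hurwitz_eq.hurwitz_sym) fact
qed (rule hurwitz_refl)

lemma hurwitz_eq_append:
  assumes "ts \<simeq> us"
  shows "ts @ ys \<simeq> us @ ys" "xs @ ts \<simeq> xs @ us"
  using hurwitz_eq_context[OF assms, of "[]" ys] hurwitz_eq_context[OF assms, of xs "[]"]
  by simp_all

lemma hurwitz_eq_length: "ts \<simeq> us \<Longrightarrow> length ts = length us"
  by (induction rule: hurwitz_eq.induct) auto

lemma arc_prod_append: "arc_prod (xs @ ys) = arc_prod xs \<circ> arc_prod ys"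
  by (induction xs rule: arc_prod.induct) auto

lemma transpose_conj:
  "transpose (transpose a b c) (transpose a b d) \<circ> transpose a b = transpose a b \<circ> transpose c d"
  by (auto simp: fun_eq_iff transpose_def)

lemma hurwitz_eq_arc_prod: "ts \<simeq> us \<Longrightarrow> arc_prod ts = arc_prod us"
proof (induction rule: hurwitz_eq.induct)
  case (hurwitz_flip xs a b ys)
  then show ?case by (simp add: arc_prod_append transpose_commute)
next
  case (hurwitz_move xs p t ys)
  obtain a b c d where "p = (a, b)" "t = (c, d)" by (cases p, cases t)
  then show ?case
    using transpose_conj[of a b c d]
    by (simp add: arc_prod_append reflect_arc_def comp_assoc[symmetric])
qed auto

lemma hurwitz_eq_arcs: "ts \<simeq> us \<Longrightarrow> set ts \<subseteq> arcs A \<longleftrightarrow> set us \<subseteq> arcs A"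
proof (induction rule: hurwitz_eq.induct)
  case (hurwitz_move xs p t ys)
  have "reflect_arc p t \<in> arcs A \<longleftrightarrow> t \<in> arcs A" if "p \<in> arcs A"
    using that by (cases p, cases t) (auto simp: arcs_def reflect_arc_def transpose_def)
  then show ?case by auto
qed (auto simp: arcs_def)

lemma hurwitz_eq_connected: "ts \<simeq> us \<Longrightarrow> arcs_connected A ts \<longleftrightarrow> arcs_connected A us"
proof (induction rule: hurwitz_eq.induct)
  case (hurwitz_flip xs a b ys)
  show ?case by (auto simp: arcs_connected_def)
next
  case (hurwitz_move xs p t ys)
  obtain a b c d where "p = (a, b)" "t = (c, d)" by (cases p, cases t)
  then have "(\<forall>(a, b) \<in> set (xs @ p # t # ys). a \<in> C \<longleftrightarrow> b \<in> C) \<longleftrightarrow>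
      (\<forall>(a, b) \<in> set (xs @ reflect_arc p t # p # ys). a \<in> C \<longleftrightarrow> b \<in> C)" for C
    by (auto simp: reflect_arc_def transpose_def)
  then show ?case unfolding arcs_connected_def by presburger
qed auto

section \<open>Moving a repeated arc through the list\<close>

lemma hurwitz_move_right: "[x, u] \<simeq> [u, reflect_arc u x]"
  using hurwitz_sym[OF hurwitz_move[of "[]" u "reflect_arc u x" "[]"]] by simp

lemma hurwitz_move_left: "[p, t] \<simeq> [reflect_arc p t, p]"
  using hurwitz_move[of "[]" p t "[]"] by simp

text \<open>A repeated arc has trivial monodromy, so it slides past every other arc.\<close>

lemma hurwitz_pair_commute: "[p, p] @ xs \<simeq> xs @ [p, p]"
proof (induction xs)
  case (Cons x xs)
  have "[p, p, x] \<simeq> [p, reflect_arc p x, p]"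
    using hurwitz_eq_context[OF hurwitz_move_left, of "[p]" p x "[]"] by simp
  also have "\<dots> \<simeq> [x, p, p]"
    using hurwitz_eq_context[OF hurwitz_move_left, of "[]" p "reflect_arc p x" "[p]"] by simp
  finally have "[p, p, x] @ xs \<simeq> [x, p, p] @ xs" by (rule hurwitz_eq_append)
  also have "\<dots> = [x] @ ([p, p] @ xs)" by simp
  also have "\<dots> \<simeq> [x] @ (xs @ [p, p])" by (rule hurwitz_eq_append[OF Cons])
  finally show ?case by simp
qed (simp add: hurwitz_refl)

text \<open>Moving \<open>x\<close> past both copies of \<open>p\<close> conjugates each of them. A
  pair commutes with everything, so it can be brought next to \<open>x\<close> and taken back to the
  end.\<close>

lemma hurwitz_pair_reflect:
  assumes "x \<in> set ts"
  shows "ts @ [p, p] \<simeq> ts @ [reflect_arc x p, reflect_arc x p]"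
proof -
  let ?p' = "reflect_arc x p"
  obtain us ws where ts: "ts = us @ x # ws" using split_list[OF assms] by blast
  have "[x, p, p] \<simeq> [?p', x, p]"
    using hurwitz_eq_context[OF hurwitz_move_left, of "[]" x p "[p]"] by simp
  also have "\<dots> \<simeq> [?p', ?p', x]"
    using hurwitz_eq_context[OF hurwitz_move_left, of "[?p']" x p "[]"] by simp
  finally have *: "[x, p, p] \<simeq> [?p', ?p', x]" .
  have "ts @ [p, p] = (us @ [x]) @ (ws @ [p, p])" by (simp add: ts)
  also have "\<dots> \<simeq> (us @ [x]) @ ([p, p] @ ws)"
    by (rule hurwitz_eq_append[OF hurwitz_sym[OF hurwitz_pair_commute]])
  also have "\<dots> = us @ [x, p, p] @ ws" by simp
  also have "\<dots> \<simeq> us @ [?p', ?p', x] @ ws" by (rule hurwitz_eq_context[OF *])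
  also have "\<dots> = us @ ([?p', ?p'] @ x # ws)" by simp
  also have "\<dots> \<simeq> us @ (x # ws @ [?p', ?p'])"
    using hurwitz_eq_append(2)[OF hurwitz_pair_commute[of ?p' "x # ws"]] by simp
  finally show ?thesis by (simp add: ts)
qed

text \<open>The pair can follow any arc \<open>(c, d)\<close> of \<open>ts\<close>: reflection in it
  swaps \<open>c\<close> and \<open>d\<close> and fixes \<open>m\<close>, which lies outside
  \<open>A\<close>. The endpoints reached from \<open>a\<close> form a set closed under arcs, hence
  all of \<open>A\<close>.\<close>

lemma hurwitz_pair_connected:
  assumes conn: "arcs_connected A ts" and ts: "set ts \<subseteq> arcs A" and m: "m \<notin> A"
    and a: "a \<in> A" and b: "b \<in> A"
  shows "ts @ [(m, a), (m, a)] \<simeq> ts @ [(m, b), (m, b)]"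
proof -
  let ?C = "{b \<in> A. ts @ [(m, a), (m, a)] \<simeq> ts @ [(m, b), (m, b)]}"
  have step: "ts @ [(m, c), (m, c)] \<simeq> ts @ [(m, d), (m, d)]"
    if cd: "(c, d) \<in> set ts \<or> (d, c) \<in> set ts" for c d
  proof -
    obtain x where x: "x \<in> set ts" "x = (c, d) \<or> x = (d, c)" using cd by blast
    then have "c \<in> A" "d \<in> A" "c \<noteq> d" using ts by (auto simp: arcs_def)
    then have "reflect_arc x (m, c) = (m, d)"
      using x m by (auto simp: reflect_arc_def transpose_def)
    then show ?thesis using hurwitz_pair_reflect[OF x(1), of "(m, c)"] by simp
  qed
  have "c \<in> ?C \<longleftrightarrow> d \<in> ?C" if "(c, d) \<in> set ts" for c d
    using ts that hurwitz_trans[OF _ step[of c d]] hurwitz_trans[OF _ step[of d c]]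
    by (auto simp: arcs_def)
  then have "\<forall>(c, d) \<in> set ts. c \<in> ?C \<longleftrightarrow> d \<in> ?C" by blast
  moreover have "a \<in> ?C" using a by (simp add: hurwitz_refl)
  moreover have "?C \<subseteq> A" by blast
  ultimately have "?C = A" using conn unfolding arcs_connected_def by blast
  then show ?thesis using b by blast
qed

section \<open>Gathering and minimizing the arcs at a vertex\<close>

abbreviation incident :: "'a \<Rightarrow> 'a \<times> 'a \<Rightarrow> bool" where
  "incident m t \<equiv> fst t = m \<or> snd t = m"

definition incidence :: "'a \<Rightarrow> ('a \<times> 'a) list \<Rightarrow> nat" where
  "incidence m ts = length (filter (incident m) ts)"

lemma incidence_append [simp]: "incidence m (xs @ ys) = incidence m xs + incidence m ys"
  by (simp add: incidence_def)

lemma incidence_Cons [simp]: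
  "incidence m (x # xs) = (if incident m x then Suc (incidence m xs) else incidence m xs)"
  by (simp add: incidence_def)

text \<open>Passing \<open>u\<close> replaces \<open>x\<close> by its reflection in
  \<open>u\<close>, and since \<open>u\<close> avoids \<open>m\<close>, this reflection still has
  \<open>m\<close> as an endpoint.\<close>

lemma hurwitz_move_past:
  assumes "\<forall>u \<in> set us. \<not> incident m u" and "incident m x"
  obtains y where "incident m y" "x # us \<simeq> us @ [y]"
  using assms
proof (induction us arbitrary: x thesis)
  case Nil
  then show ?case using hurwitz_refl[of "[x]"] by auto
next
  case (Cons u us)
  let ?x = "reflect_arc u x"
  have "incident m ?x"
    using Cons.prems(2,3) by (auto simp: reflect_arc_def transpose_def)
  then obtain y where y: "incident m y" "?x # us \<simeq> us @ [y]"
    using Cons.IH[of ?x] Cons.prems(2) by auto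
  have "x # u # us = [x, u] @ us" by simp
  also have "\<dots> \<simeq> [u, ?x] @ us" by (rule hurwitz_eq_append[OF hurwitz_move_right])
  also have "\<dots> = [u] @ (?x # us)" by simp
  also have "\<dots> \<simeq> [u] @ (us @ [y])" by (rule hurwitz_eq_append[OF y(2)])
  finally show ?case using Cons.prems(1)[of y] y(1) by simp
qed

lemma hurwitz_flip_to_source:
  assumes "\<forall>x \<in> set ws. incident m x"
  obtains as where "ws \<simeq> map (Pair m) as"
  using assms
proof (induction ws arbitrary: thesis)
  case Nil
  then show ?case using hurwitz_refl[of "[]"] Nil(1)[of "[]"] by simp
next
  case (Cons x ws)
  obtain as where as: "ws \<simeq> map (Pair m) as" using Cons by auto
  obtain a where "x = (m, a) \<or> x = (a, m)" using Cons.prems(2) by (cases x) auto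
  then have *: "[x] \<simeq> [(m, a)]"
    using hurwitz_refl hurwitz_flip[of "[]" a m "[]"] by fastforce
  have "[x] @ ws \<simeq> [(m, a)] @ ws" by (rule hurwitz_eq_append[OF *])
  also have "\<dots> \<simeq> [(m, a)] @ map (Pair m) as" by (rule hurwitz_eq_append[OF as])
  finally show ?case using Cons.prems(1)[of "a # as"] by simp
qed

text \<open>Processed from the right, each arc at \<open>m\<close> moves past the arcs already known
  to avoid \<open>m\<close>, which stay untouched; so the number of arcs at \<open>m\<close> is
  preserved.\<close>

lemma hurwitz_separate:
  obtains us as where "ts \<simeq> us @ map (Pair m) as" "\<forall>u \<in> set us. \<not> incident m u"
    "incidence m ts = length as"
proof -
  have "\<exists>us ws. ts \<simeq> us @ ws \<and> (\<forall>u \<in> set us. \<not> incident m u) \<and>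
      (\<forall>w \<in> set ws. incident m w) \<and> incidence m ts = length ws"
  proof (induction ts)
    case Nil
    then show ?case using hurwitz_refl[of "[]"] by (auto simp: incidence_def)
  next
    case (Cons x ts)
    then obtain us ws where *: "ts \<simeq> us @ ws" "\<forall>u \<in> set us. \<not> incident m u"
      "\<forall>w \<in> set ws. incident m w" "incidence m ts = length ws" by blast
    have x: "x # ts \<simeq> x # us @ ws" using hurwitz_eq_append(2)[OF *(1), of "[x]"] by simp
    show ?case
    proof (cases "incident m x")
      case True
      obtain y where y: "incident m y" "x # us \<simeq> us @ [y]"
        using hurwitz_move_past[OF *(2) True] .
      have "x # ts \<simeq> us @ (y # ws)"
        using hurwitz_trans[OF x] hurwitz_eq_append(1)[OF y(2), of ws] by simp
      then show ?thesis using * y True by (intro exI[of _ us] exI[of _ "y # ws"]) auto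
    next
      case False
      then show ?thesis using * x by (intro exI[of _ "x # us"] exI[of _ ws]) auto
    qed
  qed
  then obtain us ws where *: "ts \<simeq> us @ ws" "\<forall>u \<in> set us. \<not> incident m u"
      "\<forall>w \<in> set ws. incident m w" "incidence m ts = length ws" by blast
  obtain as where as: "ws \<simeq> map (Pair m) as" using hurwitz_flip_to_source[OF *(3)] .
  then have "length ws = length as" using hurwitz_eq_length by fastforce
  then show ?thesis
    using that[of us as] * hurwitz_trans[OF *(1) hurwitz_eq_append(2)[OF as]] by simp
qed

text \<open>Conjugating \<open>(m, b)\<close> by \<open>(m, a)\<close> gives \<open>(a, b)\<close>,
  an arc that avoids \<open>m\<close>.\<close>

lemma star_reducible:
  assumes ab: "a \<noteq> b" and m: "a \<noteq> m" "b \<noteq> m"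
  shows "\<exists>us. xs @ (m, a) # (m, b) # ys \<simeq> us \<and>
     incidence m us < incidence m (xs @ (m, a) # (m, b) # ys)"
proof -
  have "reflect_arc (m, a) (m, b) = (a, b)" using ab m by (simp add: reflect_arc_def transpose_def)
  then show ?thesis
    using hurwitz_move[of xs "(m, a)" "(m, b)" ys] m
    by (intro exI[of _ "xs @ (a, b) # (m, a) # ys"]) simp
qed

lemma adjacent_eq_replicate:
  assumes "\<And>xs a b ys. as = xs @ a # b # ys \<Longrightarrow> a = b"
  obtains j a where "as = replicate j a"
  using assms
proof (induction as arbitrary: thesis)
  case Nil
  then show ?case by (metis replicate_0)
next
  case (Cons x as)
  obtain j a where as: "as = replicate j a"
  proof (rule Cons.IH)
    show "b = c" if "as = xs @ b # c # ys" for xs b c ys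
      using Cons.prems(2)[of "x # xs"] that by simp
  qed
  show ?case
  proof (cases j)
    case 0
    then show ?thesis using Cons.prems(1)[of 1 x] as by simp
  next
    case (Suc k)
    then have "x = a" using Cons.prems(2)[of "[]" x a] as by simp
    then show ?thesis using Cons.prems(1)[of "Suc j" a] as by simp
  qed
qed

text \<open>All arcs at \<open>m\<close> end in \<open>a\<close>, so a vertex set closed under
  \<open>us\<close> becomes closed under the full list once \<open>m\<close> is put on the side of
  \<open>a\<close>.\<close>

lemma connected_remove_star:
  assumes "arcs_connected A (us @ replicate j (m, a))" and "set us \<subseteq> arcs (A - {m})"
    and "a \<in> A" "a \<noteq> m" "m \<in> A"
  shows "arcs_connected (A - {m}) us"
  unfolding arcs_connected_def
proof (intro allI impI)
  fix C assume C: "C \<subseteq> A - {m}" "\<forall>(c, d) \<in> set us. c \<in> C \<longleftrightarrow> d \<in> C"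
  let ?D = "if a \<in> C then insert m C else C"
  have "?D \<subseteq> A" using C assms(5) by auto
  moreover have "\<forall>(c, d) \<in> set (us @ replicate j (m, a)). c \<in> ?D \<longleftrightarrow> d \<in> ?D"
    using C assms(2-4) by (fastforce simp: arcs_def)
  ultimately have "?D = {} \<or> ?D = A" using assms(1) unfolding arcs_connected_def by blast
  then show "C = {} \<or> C = A - {m}" using C assms(5) by (auto split: if_splits)
qed

text \<open>
  Choose a representative with as few arcs at \<open>m\<close> as possible. Two adjacent distinct arcs at \<open>m\<close> can be
  traded for one, and among three equal ones a pair can be moved to another endpoint; so only
  one arc, or two equal ones, survive.
\<close>

lemma hurwitz_normal_form:
  assumes conn: "arcs_connected A ts" and ts: "set ts \<subseteq> arcs A"
    and m: "m \<in> A" and A: "finite A" "card A \<ge> 3"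
  obtains us a j where "ts \<simeq> us @ replicate j (m, a)" "j = 1 \<or> j = 2"
    "set us \<subseteq> arcs (A - {m})" "arcs_connected (A - {m}) us" "a \<in> A - {m}"
proof -
  obtain t where t: "ts \<simeq> t" and min: "\<And>u. ts \<simeq> u \<Longrightarrow> incidence m t \<le> incidence m u"
    using ex_has_least_nat[of "\<lambda>u. ts \<simeq> u", OF hurwitz_refl, of "incidence m"] by blast
  obtain us as where us: "t \<simeq> us @ map (Pair m) as" "\<forall>u \<in> set us. \<not> incident m u"
    "incidence m t = length as"
    using hurwitz_separate .
  have tsus: "ts \<simeq> us @ map (Pair m) as" using hurwitz_trans[OF t us(1)] .
  have inc0: "incidence m us = 0" using us(2) by (auto simp: incidence_def filter_empty_conv)
  have incP: "incidence m (map (Pair m) cs) = length cs" for cs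
    by (simp add: incidence_def filter_map o_def)
  have min': "length as \<le> incidence m u" if "us @ map (Pair m) as \<simeq> u" for u
    using min[OF hurwitz_trans[OF tsus that]] us(3) by simp
  have sub: "set (us @ map (Pair m) as) \<subseteq> arcs A" using hurwitz_eq_arcs[OF tsus] ts by blast
  then have asA: "\<And>a. a \<in> set as \<Longrightarrow> a \<in> A - {m}" by (auto simp: arcs_def)
  have usA: "set us \<subseteq> arcs (A - {m})" using sub us(2) by (auto simp: arcs_def)
  \<comment> \<open>Stated for every list \<open>ys\<close> of targets equivalent to
    \<open>as\<close>, because it is applied again after a pair has been redirected.\<close>
  have no_adj: "a = b" if "ys = xs @ a # b # zs" "set ys \<subseteq> A - {m}" "length ys = length as"
      "us @ map (Pair m) as \<simeq> us @ map (Pair m) ys" for xs a b zs ys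
  proof (rule ccontr)
    assume ab: "a \<noteq> b"
    have eq: "us @ map (Pair m) ys =
        (us @ map (Pair m) xs) @ (m, a) # (m, b) # map (Pair m) zs"
      using that(1) by simp
    have "a \<noteq> m" "b \<noteq> m" using that(1,2) by auto
    from star_reducible[OF ab this, of "us @ map (Pair m) xs" "map (Pair m) zs", folded eq]
    obtain u where "us @ map (Pair m) ys \<simeq> u"
      "incidence m u < incidence m (us @ map (Pair m) ys)" by blast
    then show False
      using min'[OF hurwitz_trans[OF that(4)], of u] inc0 incP[of ys] that(3) by simp
  qed
  have "a = b" if "as = xs @ a # b # zs" for xs a b zs
    by (rule no_adj[OF that _ refl hurwitz_refl]) (use asA in blast)
  then obtain j a where as: "as = replicate j a" by (rule adjacent_eq_replicate)
  have conn': "arcs_connected A (us @ replicate j (m, a))"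
    using hurwitz_eq_connected[OF tsus] conn by (simp add: as map_replicate)
  \<comment> \<open>Otherwise \<open>{m}\<close> would be closed under all arcs, although
    \<open>A\<close> has further vertices.\<close>
  have j0: "j \<noteq> 0"
  proof
    assume "j = 0"
    moreover have "\<forall>(c, d) \<in> set us. c \<in> {m} \<longleftrightarrow> d \<in> {m}" using us(2) by auto
    ultimately have "{m} = {} \<or> {m} = A"
      using conn'[unfolded arcs_connected_def, rule_format, of "{m}"] m by simp
    then have "{m} = A" by simp
    then show False using A(2) by auto
  qed
  then have a: "a \<in> A - {m}" using asA as by simp
  have conn_us: "arcs_connected (A - {m}) us"
    using connected_remove_star[OF conn' usA] a m by auto
  have j3: "\<not> j \<ge> 3"
  proof
    assume "j \<ge> 3"
    then obtain k where "j = 3 + k" using le_Suc_ex by blast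
    then have k: "j = Suc (Suc (Suc k))" by simp
    have "\<not> A \<subseteq> {m, a}" using A card_mono[of "{m, a}" A] by (auto simp: card_insert_if split: if_splits)
    \<comment> \<open>After a pair is redirected to the third vertex \<open>b\<close>, a target
      \<open>b\<close> stands next to the remaining \<open>a\<close>, against minimality.\<close>
    then obtain b where b: "b \<in> A" "b \<noteq> m" "b \<noteq> a" by blast
    have "us @ map (Pair m) as = (us @ [(m, a), (m, a)]) @ map (Pair m) (replicate (Suc k) a)"
      by (simp add: as k)
    also have "\<dots> \<simeq> (us @ [(m, b), (m, b)]) @ map (Pair m) (replicate (Suc k) a)"
      by (rule hurwitz_eq_append, rule hurwitz_pair_connected[OF conn_us usA]) (use a b in auto)
    also have "\<dots> = us @ map (Pair m) ([b] @ b # a # replicate k a)" by simp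
    finally have eq: "us @ map (Pair m) as \<simeq> us @ map (Pair m) ([b] @ b # a # replicate k a)" .
    have "b = a" by (rule no_adj[OF refl _ _ eq]) (use a b as k in \<open>auto split: if_splits\<close>)
    then show False using b by simp
  qed
  show thesis
    by (rule that[of us j a]) (use tsus j0 j3 usA conn_us a in \<open>auto simp: as map_replicate\<close>)
qed

section \<open>Transitivity of Hurwitz moves on connected factorizations\<close>

lemma arc_prod_fixes:
  assumes "set us \<subseteq> arcs B" "x \<notin> B"
  shows "arc_prod us x = x"
  using assms by (induction us rule: arc_prod.induct) (auto simp: arcs_def transpose_def)

lemma bij_arc_prod: "bij (arc_prod ts)"
proof (induction ts rule: arc_prod.induct)
  case (2 a b ts)
  then show ?case unfolding arc_prod.simps by (intro bij_comp) simp_all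
qed (simp only: arc_prod.simps bij_id)

text \<open>As \<open>us\<close> fixes \<open>m\<close>, the product tells the two shapes apart:
  with a single arc it sends \<open>a\<close> to \<open>m\<close>, with two the star cancels and
  \<open>m\<close> is fixed.\<close>

lemma arc_prod_replicate_star:
  assumes "set us \<subseteq> arcs (A - {m})" "a \<in> A - {m}"
  shows "arc_prod (us @ replicate 1 (m, a)) a = m"
    and "arc_prod (us @ replicate 2 (m, a)) = arc_prod us"
    and "arc_prod us = arc_prod (us @ replicate 1 (m, a)) \<circ> transpose m a"
  using arc_prod_fixes[OF assms(1), of m] assms(2)
  by (auto simp: arc_prod_append numeral_2_eq_2 fun_eq_iff)

text \<open>Induction on the number of vertices, removing a vertex \<open>m\<close> by
  \<open>hurwitz_normal_form\<close>. The common product determines the shape of the star and, for a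
  single arc, its target; for a double arc the target can be changed freely by
  \<open>hurwitz_pair_connected\<close>.\<close>

theorem hurwitz_transitive:
  assumes "finite A" and "arcs_connected A ts" "set ts \<subseteq> arcs A"
    and "arcs_connected A ts'" "set ts' \<subseteq> arcs A"
    and "length ts = length ts'" "arc_prod ts = arc_prod ts'"
  shows "ts \<simeq> ts'"
  using assms
proof (induction "card A" arbitrary: A ts ts')
  case 0
  then have "ts = []" "ts' = []" by (auto simp: arcs_def)
  then show ?case by (simp add: hurwitz_refl)
next
  case (Suc k)
  consider "Suc k = 1" | "Suc k = 2" | "Suc k \<ge> 3" by linarith
  then show ?case
  proof cases
    case 1
    then obtain a where "A = {a}" using Suc.hyps(2) by (metis card_1_singletonE)
    then have "arcs A = {}" by (auto simp: arcs_def)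
    then have "ts = []" "ts' = []" using Suc.prems by auto
    then show ?thesis by (simp add: hurwitz_refl)
  next
    case 2
    then obtain a b where A: "A = {a, b}" "a \<noteq> b" using Suc.hyps(2) by (metis card_2_iff)
    \<comment> \<open>The normal form asks for three vertices. With two there is only one
      transposition, so up to flips a list is given by its length.\<close>
    have "us \<simeq> replicate (length us) (a, b)" if "set us \<subseteq> arcs A" for us
      using that
    proof (induction us)
      case (Cons x us)
      then have "x = (a, b) \<or> x = (b, a)" by (auto simp: arcs_def A)
      then have "[x] \<simeq> [(a, b)]" using hurwitz_refl hurwitz_flip[of "[]" b a "[]"] by fastforce
      then have "[x] @ us \<simeq> [(a, b)] @ us" by (rule hurwitz_eq_append)
      also have "\<dots> \<simeq> [(a, b)] @ replicate (length us) (a, b)"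
        using Cons by (intro hurwitz_eq_append) auto
      finally show ?case by simp
    qed (simp add: hurwitz_refl)
    from this[OF Suc.prems(3)] hurwitz_sym[OF this[OF Suc.prems(5)]] show ?thesis
      unfolding Suc.prems(6) by (rule hurwitz_trans)
  next
    case 3
    then have card: "card A \<ge> 3" using Suc.hyps(2) by simp
    then obtain m where m: "m \<in> A" by fastforce
    have k: "k = card (A - {m})" using Suc.hyps(2) m Suc.prems(1) by simp
    obtain us j a where us: "ts \<simeq> us @ replicate j (m, a)" "j = 1 \<or> j = 2"
      "set us \<subseteq> arcs (A - {m})" "arcs_connected (A - {m}) us" "a \<in> A - {m}"
      by (rule hurwitz_normal_form[OF Suc.prems(2,3) m Suc.prems(1) card])
    obtain us' j' a' where us': "ts' \<simeq> us' @ replicate j' (m, a')" "j' = 1 \<or> j' = 2"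
      "set us' \<subseteq> arcs (A - {m})" "arcs_connected (A - {m}) us'" "a' \<in> A - {m}"
      by (rule hurwitz_normal_form[OF Suc.prems(4,5) m Suc.prems(1) card])
    have prod: "arc_prod (us @ replicate j (m, a)) = arc_prod (us' @ replicate j' (m, a'))"
      using hurwitz_eq_arc_prod[OF us(1)] hurwitz_eq_arc_prod[OF us'(1)] Suc.prems(7) by simp
    have len: "length us + j = length us' + j'"
      using hurwitz_eq_length[OF us(1)] hurwitz_eq_length[OF us'(1)] Suc.prems(6) by simp
    note star = arc_prod_replicate_star[OF us(3,5)]
    note star' = arc_prod_replicate_star[OF us'(3,5)]
    have fix2: "arc_prod us m = m" "arc_prod us' m = m"
      using arc_prod_fixes[OF us(3), of m] arc_prod_fixes[OF us'(3), of m] by simp_all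
    note inj = bij_is_inj[OF bij_arc_prod]
    have IH: "us \<simeq> us'" if "length us = length us'" "arc_prod us = arc_prod us'"
      using Suc.hyps(1)[OF k _ us(4,3) us'(4,3) that] Suc.prems(1) by simp
    \<comment> \<open>In the mixed cases the product would send both \<open>m\<close> and the target
      of the single arc to \<open>m\<close>.\<close>
    have jj: "j = j'"
    proof (rule ccontr)
      assume "j \<noteq> j'"
      then consider "j = 1" "j' = 2" | "j = 2" "j' = 1" using us(2) us'(2) by auto
      then show False
      proof cases
        case 1
        then have "arc_prod us' a = arc_prod us' m"
          using star(1) star'(2) prod fix2 by simp
        from injD[OF inj this] show False using us(5) by simp
      next
        case 2
        then have "arc_prod us a' = arc_prod us m"
          using star'(1) star(2) prod[symmetric] fix2 by simp
        from injD[OF inj this] show False using us'(5) by simp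
      qed
    qed
    have "us @ replicate j (m, a) \<simeq> us' @ replicate j (m, a')"
      using us(2)
    proof
      assume j: "j = 1"
      have prod1: "arc_prod (us @ replicate 1 (m, a)) = arc_prod (us' @ replicate 1 (m, a'))"
        using prod j jj by simp
      \<comment> \<open>Both \<open>a\<close> and \<open>a'\<close> are the preimage of
        \<open>m\<close> under the common product.\<close>
      then have "arc_prod (us' @ replicate 1 (m, a')) a = arc_prod (us' @ replicate 1 (m, a')) a'"
        using star(1) star'(1) by simp
      then have "a = a'" by (rule injD[OF inj])
      moreover have "arc_prod us = arc_prod us'"
        using prod1 star(3) star'(3) \<open>a = a'\<close> by simp
      ultimately have "us \<simeq> us'" using IH len jj by simp
      then show ?thesis unfolding \<open>a = a'\<close> by (rule hurwitz_eq_append)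
    next
      assume j: "j = 2"
      have "us \<simeq> us'" using IH len jj j star(2) star'(2) prod by simp
      then have "us @ [(m, a), (m, a)] \<simeq> us' @ [(m, a), (m, a)]" by (rule hurwitz_eq_append)
      also have "\<dots> \<simeq> us' @ [(m, a'), (m, a')]"
        by (rule hurwitz_pair_connected[OF us'(4,3)]) (use us us' in auto)
      finally show ?thesis using j by (simp add: numeral_2_eq_2)
    qed
    from hurwitz_trans[OF us(1) this] hurwitz_sym[OF us'(1)] show ?thesis
      unfolding jj by (rule hurwitz_trans)
  qed
qed

subsection \<open>Conjugacy of permutations from fixed point counts\<close>

locale permutation_cycle =
  fixes s :: "'a \<Rightarrow> 'a" and x :: 'a and k :: nat
  assumes inj: "inj s" and k: "k > 0" and period: "(s ^^ k) x = x"
    and minimal: "\<And>i. 0 < i \<Longrightarrow> i < k \<Longrightarrow> (s ^^ i) x \<noteq> x"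
begin

definition cycle :: "'a set" where
  "cycle = (\<lambda>i. (s ^^ i) x) ` {..<k}"

lemma funpow_eq_iff_dvd: "(s ^^ m) x = x \<longleftrightarrow> k dvd m"
proof -
  have "(s ^^ m) x = (s ^^ (m mod k)) x" using funpow_mod_eq[OF period] by simp
  then show ?thesis using minimal[of "m mod k"] k
    by (cases "m mod k = 0") (auto simp: dvd_eq_mod_eq_0)
qed

lemma inj_on_cycle: "inj_on (\<lambda>i. (s ^^ i) x) {..<k}"
proof (rule linorder_inj_onI')
  fix i j assume ij: "i \<in> {..<k}" "j \<in> {..<k}" "i < j"
  show "(s ^^ i) x \<noteq> (s ^^ j) x"
  proof
    assume eq: "(s ^^ i) x = (s ^^ j) x"
    have "(s ^^ j) x = (s ^^ i) ((s ^^ (j - i)) x)"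
      using ij funpow_add[of i "j - i" s] by simp
    with eq have "(s ^^ i) ((s ^^ (j - i)) x) = (s ^^ i) x" by simp
    then have "(s ^^ (j - i)) x = x" by (rule injD[OF inj_fn[OF inj]])
    moreover have "0 < j - i" "j - i < k" using ij by auto
    ultimately show False using minimal by blast
  qed
qed

lemma bij_betw_cycle: "bij_betw (\<lambda>i. (s ^^ i) x) {..<k} cycle"
  using inj_on_cycle by (simp add: bij_betw_def cycle_def)

lemma card_cycle: "card cycle = k" "finite cycle"
  using bij_betw_same_card[OF bij_betw_cycle] by (auto simp: cycle_def)

lemma cycle_subset: "x \<in> A \<Longrightarrow> s ` A \<subseteq> A \<Longrightarrow> cycle \<subseteq> A"
proof -
  assume "x \<in> A" "s ` A \<subseteq> A"
  then have "(s ^^ i) x \<in> A" for i by (induction i) auto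
  then show ?thesis by (auto simp: cycle_def)
qed

lemma image_cycle: "s ` cycle = cycle"
proof -
  have "s ((s ^^ i) x) \<in> cycle" if "i < k" for i
    unfolding cycle_def using k funpow_mod_eq[OF period, of "Suc i"]
    by (intro image_eqI[of _ _ "Suc i mod k"]) auto
  then have "s ` cycle \<subseteq> cycle" by (auto simp: cycle_def)
  then show ?thesis
    using card_cycle(2) inj by (intro endo_inj_surj) (auto intro: inj_on_subset)
qed

text \<open>The powers of \<open>s\<close> commute and are injective, so all points of the cycle
  share the period \<open>k\<close>: \<open>s ^^ m\<close> fixes all of them or none.\<close>

lemma fixpoints_cycle: "{z \<in> cycle. (s ^^ m) z = z} = (if k dvd m then cycle else {})"
proof -
  have "(s ^^ m) ((s ^^ i) x) = (s ^^ i) x \<longleftrightarrow> k dvd m" for i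
  proof -
    have "(s ^^ m) ((s ^^ i) x) = (s ^^ i) ((s ^^ m) x)"
      using funpow_add[of m i s] funpow_add[of i m s] by (simp add: add.commute fun_eq_iff)
    then show ?thesis using inj_fn[OF inj, of i] funpow_eq_iff_dvd[of m] by (simp add: inj_eq)
  qed
  then show ?thesis by (auto simp: cycle_def)
qed

text \<open>The correction depends only on \<open>k\<close> and \<open>m\<close>. Hence removing a
  cycle of the same length from two permutations keeps their fixed point counts equal.\<close>

lemma card_fixpoints_remove_cycle:
  assumes "finite A" "x \<in> A" "s ` A \<subseteq> A"
  shows "card {z \<in> A. (s ^^ m) z = z} =
    card {z \<in> A - cycle. (s ^^ m) z = z} + (if k dvd m then k else 0)"
proof -
  have "{z \<in> A. (s ^^ m) z = z} = {z \<in> A - cycle. (s ^^ m) z = z} \<union> {z \<in> cycle. (s ^^ m) z = z}"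
    using cycle_subset[OF assms(2,3)] by auto
  moreover have "card ({z \<in> A - cycle. (s ^^ m) z = z} \<union> {z \<in> cycle. (s ^^ m) z = z}) =
      card {z \<in> A - cycle. (s ^^ m) z = z} + card {z \<in> cycle. (s ^^ m) z = z}"
    using assms(1) card_cycle(2) by (intro card_Un_disjoint) auto
  ultimately show ?thesis by (simp add: fixpoints_cycle card_cycle)
qed

lemma image_remove_cycle:
  assumes "s ` A \<subseteq> A"
  shows "s ` (A - cycle) \<subseteq> A - cycle"
proof -
  have "s z \<notin> cycle" if "z \<notin> cycle" for z
    using that inj_image_mem_iff[OF inj, of z cycle] image_cycle by simp
  then show ?thesis using assms by auto
qed

end

text \<open>Cycles are matched one pair at a time. The least positive exponent with a fixed point is
  the length \<open>k\<close> of a shortest cycle, and the counts reveal it; so both maps have a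
  cycle of length \<open>k\<close>, and induction applies to the complements.\<close>

lemma conjugate_if_fixpoint_counts:
  assumes "finite A" "finite B" "inj s" "inj t" "s ` A \<subseteq> A" "t ` B \<subseteq> B"
    and "\<And>m. card {z \<in> A. (s ^^ m) z = z} = card {z \<in> B. (t ^^ m) z = z}"
  shows "\<exists>f. bij_betw f A B \<and> (\<forall>z \<in> A. f (s z) = t (f z))"
  using assms
proof (induction "card A" arbitrary: A B rule: less_induct)
  case less
  \<comment> \<open>The zeroth power fixes everything, so \<open>m = 0\<close> compares
    cardinalities.\<close>
  have cards: "card A = card B" using less.prems(7)[of 0] by simp
  show ?case
  proof (cases "A = {}")
    case True
    then show ?thesis using cards less.prems(2) by (auto simp: bij_betw_def)
  next
    case False
    let ?per = "\<lambda>k. k > 0 \<and> (\<exists>z \<in> A. (s ^^ k) z = z)"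
    define k where "k = (LEAST k. ?per k)"
    obtain z where z: "z \<in> A" using False by blast
    have "(s ^^ i) z \<in> A" for i using z less.prems(5) by (induction i) auto
    then have "{y. \<exists>n. y = (s ^^ n) z} \<subseteq> A" by blast
    then have "finite {y. \<exists>n. y = (s ^^ n) z}" using less.prems(1) by (rule finite_subset)
    then obtain n where "n > 0" "(s ^^ n) z = z" by (rule funpow_inj_finite[OF less.prems(3)])
    then have "?per n" using z by blast
    then have "?per k" unfolding k_def by (rule LeastI)
    then obtain x where x: "k > 0" "x \<in> A" "(s ^^ k) x = x" by blast
    have min: "\<not> ?per i" if "i < k" for i using not_less_Least[of i ?per] that unfolding k_def .
    \<comment> \<open>The counts vanish together, so \<open>k\<close> is also the least positive
      exponent for which a power of \<open>t\<close> has a fixed point in \<open>B\<close>.\<close>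
    have pos_iff: "(\<exists>z \<in> A. (s ^^ m) z = z) \<longleftrightarrow> (\<exists>z \<in> B. (t ^^ m) z = z)" for m
    proof -
      have "{z \<in> A. (s ^^ m) z = z} = {} \<longleftrightarrow> {z \<in> B. (t ^^ m) z = z} = {}"
        using less.prems(7)[of m] less.prems(1,2) card_0_eq[of "{z \<in> A. (s ^^ m) z = z}"]
          card_0_eq[of "{z \<in> B. (t ^^ m) z = z}"] by simp
      then show ?thesis by blast
    qed
    obtain y where y: "y \<in> B" "(t ^^ k) y = y" using pos_iff[of k] x by blast
    interpret s: permutation_cycle s x k
    proof
      show "(s ^^ i) x \<noteq> x" if "0 < i" "i < k" for i
        using min[OF that(2)] that(1) x(2) by blast
    qed (use x less.prems(3) in auto)
    interpret t: permutation_cycle t y k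
    proof
      show "(t ^^ i) y \<noteq> y" if "0 < i" "i < k" for i
        using min[OF that(2)] pos_iff[of i] that(1) y(1) by blast
    qed (use x y less.prems(4) in auto)
    have "card (A - s.cycle) < card A"
    proof (intro psubset_card_mono less.prems(1))
      have "s.cycle \<noteq> {}" using s.card_cycle x(1) by auto
      then show "A - s.cycle \<subset> A" using s.cycle_subset[OF x(2) less.prems(5)] by blast
    qed
    moreover have "card {z \<in> A - s.cycle. (s ^^ m) z = z} = card {z \<in> B - t.cycle. (t ^^ m) z = z}" for m
      using s.card_fixpoints_remove_cycle[OF less.prems(1) x(2) less.prems(5), of m]
        t.card_fixpoints_remove_cycle[OF less.prems(2) y(1) less.prems(6), of m]
        less.prems(7)[of m] by simp
    ultimately have "\<exists>f. bij_betw f (A - s.cycle) (B - t.cycle) \<and>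
        (\<forall>z \<in> A - s.cycle. f (s z) = t (f z))"
      using less.hyps[of "A - s.cycle" "B - t.cycle"] less.prems(1-4)
        s.image_remove_cycle[OF less.prems(5)] t.image_remove_cycle[OF less.prems(6)] by blast
    then obtain f where f: "bij_betw f (A - s.cycle) (B - t.cycle)"
      "\<forall>z \<in> A - s.cycle. f (s z) = t (f z)"
      by blast
    define g where "g = (\<lambda>i. (t ^^ i) y) \<circ> the_inv_into {..<k} (\<lambda>i. (s ^^ i) x)"
    have g: "bij_betw g s.cycle t.cycle"
      unfolding g_def using bij_betw_the_inv_into[OF s.bij_betw_cycle] t.bij_betw_cycle
      by (rule bij_betw_trans)
    have g_pow: "g ((s ^^ i) x) = (t ^^ i) y" if "i < k" for i
      using that by (simp add: g_def the_inv_into_f_f[OF s.inj_on_cycle])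
    have g_eq: "g (s z) = t (g z)" if z: "z \<in> s.cycle" for z
    proof -
      obtain i where i: "i < k" "z = (s ^^ i) x" using z by (auto simp: s.cycle_def)
      show ?thesis
      \<comment> \<open>\<open>g_pow\<close> covers exponents below \<open>k\<close> only, so the
        return to the base point is treated apart.\<close>
      proof (cases "Suc i = k")
        case True
        have "s z = (s ^^ Suc i) x" using i(2) by simp
        then have "s z = x" unfolding True x(3) .
        moreover have "t (g z) = (t ^^ Suc i) y" using g_pow[OF i(1)] i(2) by simp
        then have "t (g z) = y" unfolding True y(2) .
        ultimately show ?thesis using g_pow[of 0] x(1) by simp
      next
        case False
        then show ?thesis using g_pow[of "Suc i"] g_pow[OF i(1)] i by simp
      qed
    qed
    define h where "h z = (if z \<in> s.cycle then g z else f z)" for z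
    have "bij_betw h s.cycle t.cycle" using g by (rule bij_betw_cong[THEN iffD1, rotated]) (simp add: h_def)
    moreover have "bij_betw h (A - s.cycle) (B - t.cycle)"
      using f(1) by (rule bij_betw_cong[THEN iffD1, rotated]) (simp add: h_def)
    ultimately have "bij_betw h (s.cycle \<union> (A - s.cycle)) (t.cycle \<union> (B - t.cycle))"
      by (rule bij_betw_combine) auto
    moreover have "s.cycle \<union> (A - s.cycle) = A" "t.cycle \<union> (B - t.cycle) = B"
      using s.cycle_subset[OF x(2) less.prems(5)] t.cycle_subset[OF y(1) less.prems(6)] by auto
    moreover have "h (s z) = t (h z)" if "z \<in> A" for z
    proof (cases "z \<in> s.cycle")
      case True
      then have "s z \<in> s.cycle" using s.image_cycle by blast
      then show ?thesis using True g_eq[of z] by (simp add: h_def)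
    next
      case False
      then have "s z \<notin> s.cycle" using s.image_remove_cycle[OF less.prems(5)] that by blast
      then show ?thesis using False f(2) that by (simp add: h_def)
    qed
    ultimately show ?thesis by auto
  qed
qed

subsection \<open>Traces, permutation matrices and Sylvester's identity\<close>

definition mat_trace :: "'a :: comm_ring_1 mat \<Rightarrow> 'a" where
  "mat_trace A = (\<Sum>i<dim_row A. A $$ (i, i))"

lemma mat_mult_index:
  assumes "A \<in> carrier_mat n m" "B \<in> carrier_mat m l" "i < n" "j < l"
  shows "(A * B) $$ (i, j) = (\<Sum>k<m. A $$ (i, k) * B $$ (k, j))"
  using assms by (auto simp: scalar_prod_def lessThan_atLeast0 intro!: sum.cong)

lemma mat_trace_mult_commute:
  assumes "A \<in> carrier_mat n m" "B \<in> carrier_mat m n"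
  shows "mat_trace (A * B) = mat_trace (B * A)"
proof -
  have "mat_trace (A * B) = (\<Sum>i<n. \<Sum>k<m. A $$ (i, k) * B $$ (k, i))"
    using assms by (auto simp: mat_trace_def mat_mult_index[of _ n m _ n] simp del: index_mult_mat(1))
  also have "\<dots> = (\<Sum>k<m. \<Sum>i<n. B $$ (k, i) * A $$ (i, k))"
    by (subst sum.swap) (simp add: mult.commute)
  also have "\<dots> = mat_trace (B * A)"
    using assms by (auto simp: mat_trace_def mat_mult_index[of _ m n _ m] simp del: index_mult_mat(1))
  finally show ?thesis .
qed

lemma mat_trace_similar:
  assumes "similar_mat_wit A B P Q"
  shows "mat_trace (A ^\<^sub>m k) = mat_trace (B ^\<^sub>m k)"
proof -
  define n where "n = dim_row A"
  note wit = similar_mat_witD[OF n_def assms]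
  have "mat_trace (A ^\<^sub>m k) = mat_trace (P * (B ^\<^sub>m k * Q))"
    using similar_mat_wit_pow_id[OF assms, of k] wit(5-7) by (simp add: assoc_mult_mat[of _ n n _ n _ n])
  also have "\<dots> = mat_trace (B ^\<^sub>m k * Q * P)"
    using wit by (intro mat_trace_mult_commute[of _ n n]) (auto intro!: mult_carrier_mat)
  also have "B ^\<^sub>m k * Q * P = B ^\<^sub>m k" using wit by (simp add: assoc_mult_mat[of _ n n _ n _ n])
  finally show ?thesis .
qed

lemma upper_triangular_pow:
  fixes B :: "'a :: comm_ring_1 mat"
  assumes B: "B \<in> carrier_mat n n" "upper_triangular B"
  shows "upper_triangular (B ^\<^sub>m k) \<and> (\<forall>i<n. (B ^\<^sub>m k) $$ (i, i) = (B $$ (i, i)) ^ k)"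
proof (induction k)
  case 0
  then show ?case using B by auto
next
  case (Suc k)
  let ?C = "B ^\<^sub>m k"
  have C: "?C \<in> carrier_mat n n" using B by simp
  have zero: "?C $$ (i, j) = 0" "B $$ (i, j) = 0" if "j < i" "i < n" for i j
    using that Suc B C upper_triangularD by (metis carrier_matD(1))+
  have entry: "(?C * B) $$ (i, j) = (\<Sum>l\<in>{i..j}. ?C $$ (i, l) * B $$ (l, j))" if "i < n" "j < n" for i j
  proof -
    have "(?C * B) $$ (i, j) = (\<Sum>l<n. ?C $$ (i, l) * B $$ (l, j))"
      by (rule mat_mult_index[OF C B(1) that])
    also have "\<dots> = (\<Sum>l\<in>{i..j}. ?C $$ (i, l) * B $$ (l, j))"
      using that zero by (intro sum.mono_neutral_right) (auto simp: not_le)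
    finally show ?thesis .
  qed
  show ?case
    using entry Suc B C by (auto simp: upper_triangular_def mult.commute simp del: index_mult_mat(1))
qed

text \<open>Schur triangularization puts the same eigenvalue list \<open>es\<close> on both
  diagonals, and the trace of the k-th power is the k-th power sum of \<open>es\<close>. Over the
  complex numbers the characteristic polynomial splits, which makes this possible.\<close>

lemma mat_trace_pow_eq:
  fixes A B :: "complex mat"
  assumes A: "A \<in> carrier_mat n n" and B: "B \<in> carrier_mat n n"
    and eq: "char_poly A = char_poly B"
  shows "mat_trace (A ^\<^sub>m k) = mat_trace (B ^\<^sub>m k)"
proof -
  obtain es where es: "char_poly A = (\<Prod>e\<leftarrow>es. [:- e, 1:])" using char_poly_factorized[OF A] by blast
  have "mat_trace (C ^\<^sub>m k) = (\<Sum>e\<leftarrow>es. e ^ k)"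
    if C: "C \<in> carrier_mat n n" and cp: "char_poly C = char_poly A" for C
  proof -
    obtain T P Q where T: "schur_decomposition C es = (T, P, Q)" by (metis prod_cases3)
    have sd: "similar_mat_wit C T P Q" "upper_triangular T" "diag_mat T = es"
      using schur_decomposition[OF C _ T] cp es by auto
    have Tc: "T \<in> carrier_mat n n" using similar_mat_witD2[OF C sd(1)] by blast
    have "mat_trace (C ^\<^sub>m k) = mat_trace (T ^\<^sub>m k)" by (rule mat_trace_similar[OF sd(1)])
    also have "\<dots> = (\<Sum>i<n. (T $$ (i, i)) ^ k)"
      using upper_triangular_pow[OF Tc sd(2), of k] Tc by (simp add: mat_trace_def)
    also have "\<dots> = (\<Sum>e\<leftarrow>es. e ^ k)"
      using Tc by (simp add: sd(3)[symmetric] diag_mat_def sum_list_sum_nth o_def lessThan_atLeast0)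
    finally show ?thesis .
  qed
  then show ?thesis using A B eq by simp
qed

text \<open>Column \<open>j\<close> is the unit vector at \<open>s j\<close>; with this orientation,
  composition of maps becomes the matrix product in the same order.\<close>

definition map_to_mat :: "nat \<Rightarrow> (nat \<Rightarrow> nat) \<Rightarrow> 'a :: comm_ring_1 mat" where
  "map_to_mat n s = mat n n (\<lambda>(i, j). of_bool (i = s j))"

lemma map_to_mat_carrier [simp]: "map_to_mat n s \<in> carrier_mat n n"
  by (simp add: map_to_mat_def)

lemma map_to_mat_pow:
  assumes "s ` {..<n} \<subseteq> {..<n}"
  shows "(map_to_mat n s :: 'a :: comm_ring_1 mat) ^\<^sub>m k = map_to_mat n (s ^^ k)"
proof (induction k)
  case 0
  show ?case by (rule eq_matI) (auto simp: map_to_mat_def)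
next
  case (Suc k)
  show ?case
  proof (rule eq_matI)
    fix i j assume "i < dim_row (map_to_mat n (s ^^ Suc k) :: 'a mat)"
      "j < dim_col (map_to_mat n (s ^^ Suc k) :: 'a mat)"
    then have ij: "i < n" "j < n" by (auto simp: map_to_mat_def)
    then have sj: "s j < n" using assms by auto
    have "((map_to_mat n s :: 'a mat) ^\<^sub>m Suc k) $$ (i, j) =
        (map_to_mat n (s ^^ k) * map_to_mat n s) $$ (i, j)"
      by (simp add: Suc)
    also have "\<dots> = (\<Sum>l<n. map_to_mat n (s ^^ k) $$ (i, l) * map_to_mat n s $$ (l, j))"
      by (rule mat_mult_index[OF _ _ ij]) simp_all
    also have "\<dots> = (\<Sum>l<n. if l = s j then of_bool (i = (s ^^ k) l) else 0)"
      using ij by (intro sum.cong) (auto simp: map_to_mat_def)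
    also have "\<dots> = (map_to_mat n (s ^^ Suc k) :: 'a mat) $$ (i, j)"
      using ij sj by (simp add: map_to_mat_def funpow_swap1)
    finally show "((map_to_mat n s :: 'a mat) ^\<^sub>m Suc k) $$ (i, j) =
        (map_to_mat n (s ^^ Suc k) :: 'a mat) $$ (i, j)" .
  qed (simp_all add: map_to_mat_def)
qed

text \<open>The trace of the k-th power of the matrix counts the fixed points of
  \<open>s ^^ k\<close>, and traces of powers are determined by the characteristic polynomial after
  passing to the complex numbers.\<close>

lemma fixpoint_counts_if_char_poly_eq:
  assumes s: "s ` {..<n} \<subseteq> {..<n}" and t: "t ` {..<n} \<subseteq> {..<n}"
    and eq: "char_poly (map_to_mat n s :: int mat) = char_poly (map_to_mat n t)"
  shows "card {i \<in> {..<n}. (s ^^ k) i = i} = card {i \<in> {..<n}. (t ^^ k) i = i}"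
proof -
  have hom: "char_poly (map_to_mat n u :: complex mat) =
      map_poly of_int (char_poly (map_to_mat n u :: int mat))" for u
  proof -
    have "map_mat of_int (map_to_mat n u :: int mat) = (map_to_mat n u :: complex mat)"
      by (rule eq_matI) (auto simp: map_to_mat_def)
    moreover have "char_poly (map_mat of_int (map_to_mat n u :: int mat) :: complex mat) =
        map_poly of_int (char_poly (map_to_mat n u :: int mat))"
      by (rule of_int_hom.char_poly_hom[OF map_to_mat_carrier])
    ultimately show ?thesis by simp
  qed
  have trace: "mat_trace (map_to_mat n u :: complex mat) = of_nat (card {i \<in> {..<n}. u i = i})" for u
  proof -
    have "mat_trace (map_to_mat n u :: complex mat) = (\<Sum>i<n. of_bool (u i = i))"
      unfolding mat_trace_def by (rule sum.cong) (auto simp: map_to_mat_def)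
    then show ?thesis by (simp add: Int_def)
  qed
  have "mat_trace (map_to_mat n s ^\<^sub>m k) = mat_trace (map_to_mat n t ^\<^sub>m k :: complex mat)"
    by (rule mat_trace_pow_eq[of _ n]) (simp_all add: hom eq)
  then show ?thesis by (simp add: map_to_mat_pow s t trace)
qed

section \<open>Sylvester's determinant identity\<close>

lemma sylvester_determinant:
  fixes A B :: "'a :: idom mat"
  assumes A: "A \<in> carrier_mat n m" and B: "B \<in> carrier_mat m n"
  shows "y ^ m * det (y \<cdot>\<^sub>m 1\<^sub>m n + A * B) = y ^ n * det (y \<cdot>\<^sub>m 1\<^sub>m m + B * A)"
proof -
  \<comment> \<open>Right multiplication by \<open>?L\<close> or \<open>?R\<close> clears one
    off-diagonal block of \<open>?M\<close>. Rather than dividing by \<open>y\<close>,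
    \<open>?R\<close> scales the last \<open>m\<close> columns by it, whence the factor
    \<open>y ^ m\<close>.\<close>
  let ?M = "four_block_mat (y \<cdot>\<^sub>m 1\<^sub>m n) (- A) B (1\<^sub>m m)"
  let ?L = "four_block_mat (1\<^sub>m n) (0\<^sub>m n m) (- B) (1\<^sub>m m)"
  let ?R = "four_block_mat (1\<^sub>m n) A (0\<^sub>m m n) (y \<cdot>\<^sub>m 1\<^sub>m m)"
  have M: "?M \<in> carrier_mat (n + m) (n + m)" using A B by auto
  have "?M * ?L = four_block_mat (y \<cdot>\<^sub>m 1\<^sub>m n + A * B) (- A) (0\<^sub>m m n) (1\<^sub>m m)"
    using A B
    by (subst mult_four_block_mat[of _ n n _ m _ m _ _ n _ m]) auto
  moreover have "det (?M * ?L) = det ?M * det ?L" using A B by (intro det_mult[OF M]) auto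
  moreover have "det ?L = 1"
    using B by (subst det_four_block_mat_upper_right_zero[of _ n _ m]) auto
  moreover have "det (four_block_mat (y \<cdot>\<^sub>m 1\<^sub>m n + A * B) (- A) (0\<^sub>m m n) (1\<^sub>m m)) = det (y \<cdot>\<^sub>m 1\<^sub>m n + A * B)"
    using A B by (subst det_four_block_mat_lower_left_zero[of _ n _ m]) auto
  ultimately have 1: "det ?M = det (y \<cdot>\<^sub>m 1\<^sub>m n + A * B)" by simp
  have "y \<cdot>\<^sub>m 1\<^sub>m n * A + - (A * (y \<cdot>\<^sub>m 1\<^sub>m m)) = 0\<^sub>m n m"
    using A by (intro eq_matI) (auto simp: mult_smult_distrib[of _ n m _ m] mult_smult_assoc_mat[of _ n n _ m])
  then have "?M * ?R = four_block_mat (y \<cdot>\<^sub>m 1\<^sub>m n) (0\<^sub>m n m) B (y \<cdot>\<^sub>m 1\<^sub>m m + B * A)"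
    using A B
    by (subst mult_four_block_mat[of _ n n _ m _ m _ _ n _ m]) (auto simp: comm_add_mat[of _ m m])
  moreover have "det (?M * ?R) = det ?M * det ?R" using A B by (intro det_mult[OF M]) auto
  moreover have "det ?R = y ^ m"
    using A by (subst det_four_block_mat_lower_left_zero[of _ n _ m]) auto
  moreover have "det (four_block_mat (y \<cdot>\<^sub>m 1\<^sub>m n) (0\<^sub>m n m) B (y \<cdot>\<^sub>m 1\<^sub>m m + B * A)) =
      y ^ n * det (y \<cdot>\<^sub>m 1\<^sub>m m + B * A)"
    using A B by (subst det_four_block_mat_upper_right_zero[of _ n _ m]) auto
  ultimately show ?thesis unfolding 1 by (simp add: mult.commute)
qed

text \<open>Sylvester's identity over polynomials at \<open>y = x - 1\<close>: the characteristic
  matrix of \<open>1 - A B\<close> is \<open>(x - 1) + A B\<close>.\<close>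

lemma char_poly_one_minus_mult:
  fixes A B :: "'a :: idom mat"
  assumes A: "A \<in> carrier_mat n m" and B: "B \<in> carrier_mat m n"
  shows "[:-1, 1:] ^ m * char_poly (1\<^sub>m n - A * B) = [:-1, 1:] ^ n * char_poly (1\<^sub>m m - B * A)"
proof -
  let ?h = "map_mat (\<lambda>a :: 'a. [:a:])"
  have *: "char_poly (1\<^sub>m n - A * B) = det ([:-1, 1:] \<cdot>\<^sub>m 1\<^sub>m n + ?h A * ?h B)"
    if A: "A \<in> carrier_mat n m" and B: "B \<in> carrier_mat m n" for A B n m
  proof -
    have "char_poly_matrix (1\<^sub>m n - A * B) = [:-1, 1:] \<cdot>\<^sub>m 1\<^sub>m n + ?h (A * B)"
      using A B by (intro eq_matI) (auto simp: char_poly_matrix_def one_pCons)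
    then show ?thesis by (simp add: char_poly_def map_poly_mult[OF A B])
  qed
  show ?thesis
    unfolding *[OF A B] *[OF B A] using A B by (intro sylvester_determinant) auto
qed

subsection \<open>Gram and Coxeter matrices of lists of arcs\<close>

text \<open>The root \<open>e_s - e_t\<close>, as a function on vertices so that the vertex type
  stays arbitrary.\<close>

definition arc_vec :: "'a \<times> 'a \<Rightarrow> 'a \<Rightarrow> int" where
  "arc_vec t k = of_bool (k = fst t) - of_bool (k = snd t)"

text \<open>The Euclidean inner product of two roots, obtained by evaluating one root at the
  endpoints of the other instead of summing over vertices.\<close>

definition arc_inner :: "'a \<times> 'a \<Rightarrow> 'a \<times> 'a \<Rightarrow> int" where
  "arc_inner t u = arc_vec t (fst u) - arc_vec t (snd u)"

text \<open>The diagonal entry 1 is half the squared length 2 of a root, so that adding the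
  transpose gives the full Gram matrix.\<close>

definition arc_gram :: "('a \<times> 'a) list \<Rightarrow> int mat" where
  "arc_gram ts = mat (length ts) (length ts)
     (\<lambda>(i, j). if i = j then 1 else if i < j then arc_inner (ts ! i) (ts ! j) else 0)"

lemma arc_gram_carrier [simp]: "arc_gram ts \<in> carrier_mat (length ts) (length ts)"
  by (simp add: arc_gram_def)

lemma arc_gram_dim [simp]: "dim_row (arc_gram ts) = length ts" "dim_col (arc_gram ts) = length ts"
  by (simp_all add: arc_gram_def)

lemma arc_gram_index:
  "i < length ts \<Longrightarrow> j < length ts \<Longrightarrow> arc_gram ts $$ (i, j) =
     (if i = j then 1 else if i < j then arc_inner (ts ! i) (ts ! j) else 0)"
  by (simp add: arc_gram_def)

lemma det_arc_gram: "det (arc_gram ts) = 1"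
  by (subst det_upper_triangular[of _ "length ts"])
    (auto simp: arc_gram_def diag_mat_def intro!: prod_list_neutral)

lemma arc_inner_commute: "arc_inner t u = arc_inner u t"
  by (auto simp: arc_inner_def arc_vec_def)

lemma arc_inner_self: "fst t \<noteq> snd t \<Longrightarrow> arc_inner t t = 2"
  by (simp add: arc_inner_def arc_vec_def)

lemma sum_arc_vec:
  assumes "finite A" "fst t \<in> A" "snd t \<in> A"
  shows "(\<Sum>k\<in>A. f k * arc_vec t k) = f (fst t) - f (snd t)"
proof -
  have "(\<Sum>k\<in>A. f k * arc_vec t k) =
      (\<Sum>k\<in>A. if k = fst t then f k else 0) - (\<Sum>k\<in>A. if k = snd t then f k else 0)"
    unfolding sum_subtractf[symmetric] by (rule sum.cong) (auto simp: arc_vec_def)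
  then show ?thesis using assms by simp
qed

lemma arc_vec_mult:
  "fst t \<noteq> snd t \<Longrightarrow>
     arc_vec t k * arc_vec t w = of_bool (k = w) - of_bool (k = transpose (fst t) (snd t) w)"
  by (auto simp: arc_vec_def transpose_def)

lemma arc_prod_in: "set ts \<subseteq> arcs A \<Longrightarrow> x \<in> A \<Longrightarrow> arc_prod ts x \<in> A"
  by (induction ts rule: arc_prod.induct) (auto simp: arcs_def transpose_def)

text \<open>
  Since \<open>v\<^sub>j v\<^sub>j\<^sup>T\<close> is the difference of the identity and the reflection along \<open>v\<^sub>j\<close>, the sum telescopes.
\<close>

lemma sum_arc_vec_telescope:
  assumes "set ts \<subseteq> arcs A" "i \<le> length ts"
  shows "(\<Sum>j = i..<length ts. arc_vec (ts ! j) k * arc_vec (ts ! j) (arc_prod (drop (Suc j) ts) x)) =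
    of_bool (k = x) - of_bool (k = arc_prod (drop i ts) x)"
proof -
  let ?g = "\<lambda>j. of_bool (k = arc_prod (drop j ts) x) :: int"
  have "arc_vec (ts ! j) k * arc_vec (ts ! j) (arc_prod (drop (Suc j) ts) x) = ?g (Suc j) - ?g j"
    if "j < length ts" for j
  proof -
    have "ts ! j \<in> arcs A" using assms(1) that by auto
    then have "fst (ts ! j) \<noteq> snd (ts ! j)" by (auto simp: arcs_def)
    moreover have "arc_prod (drop j ts) = transpose (fst (ts ! j)) (snd (ts ! j)) \<circ> arc_prod (drop (Suc j) ts)"
      using Cons_nth_drop_Suc[OF that] by (metis arc_prod.simps(2) prod.collapse)
    ultimately show ?thesis by (simp add: arc_vec_mult)
  qed
  then have "(\<Sum>j = i..<length ts. arc_vec (ts ! j) k * arc_vec (ts ! j) (arc_prod (drop (Suc j) ts) x)) =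
      (\<Sum>j = i..<length ts. ?g (Suc j) - ?g j)" by (intro sum.cong) auto
  also have "\<dots> = ?g (length ts) - ?g i" using assms(2) by (rule sum_Suc_diff')
  finally show ?thesis by simp
qed

text \<open>\<open>V^T\<close> and \<open>V G^-1\<close> are the two factors fed into
  \<open>char_poly_one_minus_mult\<close>. One order of multiplication gives the Coxeter matrix
  because \<open>V^T V = G + G^T\<close>, the other the permutation matrix by telescoping.\<close>

lemma coxeter_arc_gram:
  assumes ts: "set ts \<subseteq> arcs {..<N}"
  shows "[:-1, 1:] ^ N * char_poly (- (transpose_mat (arc_gram ts) * int_mat_inverse (arc_gram ts))) =
    [:-1, 1:] ^ length ts * char_poly (map_to_mat N (arc_prod ts))"
proof -
  let ?n = "length ts" and ?U = "arc_gram ts"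
  let ?I = "int_mat_inverse ?U"
  define V where "V = mat N ?n (\<lambda>(k, i). arc_vec (ts ! i) k)"
  \<comment> \<open>\<open>Y\<close> is \<open>G^-1 V^T\<close> as back substitution produces it:
    row \<open>i\<close> is the root of the \<open>i\<close>-th arc composed with the product of all
    later transpositions.\<close>
  define Y where "Y = mat ?n N (\<lambda>(i, x). arc_vec (ts ! i) (arc_prod (drop (Suc i) ts) x))"
  have V: "V \<in> carrier_mat N ?n" and Y: "Y \<in> carrier_mat ?n N" by (simp_all add: V_def Y_def)
  have VT: "transpose_mat V \<in> carrier_mat ?n N" using V by simp
  note U = arc_gram_carrier[of ts]
  note I = int_mat_inverse[OF U det_arc_gram]
  have arc: "fst (ts ! i) < N" "snd (ts ! i) < N" "fst (ts ! i) \<noteq> snd (ts ! i)" if "i < ?n" for i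
    using nth_mem[OF that] ts by (auto simp: arcs_def)
  have inner: "(\<Sum>k<N. arc_vec (ts ! i) k * arc_vec (ts ! j) k) = arc_inner (ts ! i) (ts ! j)"
    if "j < ?n" for i j
    using arc[OF that] by (simp add: sum_arc_vec arc_inner_def)
  have gram: "transpose_mat V * V = ?U + transpose_mat ?U"
  proof (rule eq_matI)
    fix i j assume "i < dim_row (?U + transpose_mat ?U)" "j < dim_col (?U + transpose_mat ?U)"
    then have ij: "i < ?n" "j < ?n" by (auto simp: arc_gram_def)
    have "(transpose_mat V * V) $$ (i, j) = (\<Sum>k<N. transpose_mat V $$ (i, k) * V $$ (k, j))"
      by (rule mat_mult_index[OF VT V ij])
    also have "\<dots> = arc_inner (ts ! i) (ts ! j)"
      using ij by (simp add: V_def inner)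
    also have "\<dots> = (?U + transpose_mat ?U) $$ (i, j)"
      using ij arc by (auto simp: arc_gram_index arc_inner_self arc_inner_commute)
    finally show "(transpose_mat V * V) $$ (i, j) = (?U + transpose_mat ?U) $$ (i, j)" .
  qed (use V in \<open>auto simp: arc_gram_def\<close>)
  have VY: "V * Y = 1\<^sub>m N - map_to_mat N (arc_prod ts)"
  proof (rule eq_matI)
    fix k x assume "k < dim_row (1\<^sub>m N - map_to_mat N (arc_prod ts) :: int mat)"
      "x < dim_col (1\<^sub>m N - map_to_mat N (arc_prod ts) :: int mat)"
    then have kx: "k < N" "x < N" by (auto simp: map_to_mat_def)
    have "(V * Y) $$ (k, x) = (\<Sum>j<?n. V $$ (k, j) * Y $$ (j, x))"
      by (rule mat_mult_index[OF V Y kx])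
    also have "\<dots> = (\<Sum>j = 0..<?n. arc_vec (ts ! j) k * arc_vec (ts ! j) (arc_prod (drop (Suc j) ts) x))"
      using kx by (simp add: V_def Y_def lessThan_atLeast0)
    also have "\<dots> = (1\<^sub>m N - map_to_mat N (arc_prod ts)) $$ (k, x)"
      using sum_arc_vec_telescope[OF ts, of 0] kx by (simp add: map_to_mat_def)
    finally show "(V * Y) $$ (k, x) = (1\<^sub>m N - map_to_mat N (arc_prod ts)) $$ (k, x)" .
  qed (use V Y in \<open>auto simp: map_to_mat_def\<close>)
  have UY: "?U * Y = transpose_mat V"
  proof (rule eq_matI)
    fix i x assume "i < dim_row (transpose_mat V)" "x < dim_col (transpose_mat V)"
    then have ix: "i < ?n" "x < N" using V by auto
    let ?y = "\<lambda>j. arc_vec (ts ! j) (arc_prod (drop (Suc j) ts) x)"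
    have drop_in: "arc_prod (drop (Suc i) ts) x < N"
      using arc_prod_in[of "drop (Suc i) ts" "{..<N}" x] ts ix set_drop_subset[of "Suc i" ts] by auto
    have "(?U * Y) $$ (i, x) = (\<Sum>j<?n. ?U $$ (i, j) * Y $$ (j, x))"
      by (rule mat_mult_index[OF U Y ix])
    also have "\<dots> = (\<Sum>j = i..<?n. ?U $$ (i, j) * ?y j)"
      using ix by (intro sum.mono_neutral_cong_right) (auto simp: Y_def arc_gram_index)
    \<comment> \<open>The diagonal term is split off because its entry is 1, whereas
      \<open>arc_inner\<close> would give 2.\<close>
    also have "\<dots> = ?y i + (\<Sum>j = Suc i..<?n. arc_inner (ts ! i) (ts ! j) * ?y j)"
      using ix by (subst sum.atLeast_Suc_lessThan) (auto simp: arc_gram_index)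
    also have "(\<Sum>j = Suc i..<?n. arc_inner (ts ! i) (ts ! j) * ?y j) =
        (\<Sum>j = Suc i..<?n. \<Sum>k<N. arc_vec (ts ! i) k * (arc_vec (ts ! j) k * ?y j))"
      by (intro sum.cong) (simp_all add: inner[symmetric] sum_distrib_right mult.assoc)
    also have "\<dots> = (\<Sum>k<N. arc_vec (ts ! i) k * (\<Sum>j = Suc i..<?n. arc_vec (ts ! j) k * ?y j))"
      by (subst sum.swap) (simp add: sum_distrib_left)
    also have "\<dots> = (\<Sum>k<N. arc_vec (ts ! i) k *
        (of_bool (k = x) - of_bool (k = arc_prod (drop (Suc i) ts) x)))"
      using ix by (simp add: sum_arc_vec_telescope[OF ts])
    \<comment> \<open>The difference of indicators is the root of an auxiliary arc, possibly a loop,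
      so \<open>sum_arc_vec\<close> applies.\<close>
    also have "\<dots> = (\<Sum>k<N. arc_vec (ts ! i) k * arc_vec (x, arc_prod (drop (Suc i) ts) x) k)"
      by (simp add: arc_vec_def)
    also have "\<dots> = arc_vec (ts ! i) x - ?y i"
      using ix drop_in by (subst sum_arc_vec) auto
    finally show "(?U * Y) $$ (i, x) = transpose_mat V $$ (i, x)"
      using ix V by (simp add: V_def)
  qed (use V Y in \<open>auto simp: arc_gram_def\<close>)
  have VI: "V * ?I \<in> carrier_mat N ?n" using V I(1) by simp
  have IV: "?I * transpose_mat V = Y"
  proof -
    have "?I * transpose_mat V = (?I * ?U) * Y"
      unfolding UY[symmetric] by (rule assoc_mult_mat[OF I(1) U Y, symmetric])
    then show ?thesis using I(3) Y by simp
  qed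
  have "(V * ?I) * transpose_mat V = V * Y"
    using assoc_mult_mat[OF V I(1) VT] IV by simp
  then have P: "1\<^sub>m N - (V * ?I) * transpose_mat V = map_to_mat N (arc_prod ts)"
    unfolding VY by (intro eq_matI) (auto simp: map_to_mat_def)
  have "transpose_mat V * (V * ?I) = (?U + transpose_mat ?U) * ?I"
    using assoc_mult_mat[OF VT V I(1)] gram by simp
  also have "\<dots> = 1\<^sub>m ?n + transpose_mat ?U * ?I"
    using I U by (simp add: add_mult_distrib_mat[of _ ?n ?n])
  finally have C: "1\<^sub>m ?n - transpose_mat V * (V * ?I) = - (transpose_mat ?U * ?I)"
    using I U by (intro eq_matI) auto
  show ?thesis
    using char_poly_one_minus_mult[OF VT VI] unfolding P C .
qed

subsection \<open>Integral congruence\<close>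

definition int_congruent :: "nat \<Rightarrow> int mat \<Rightarrow> int mat \<Rightarrow> bool" where
  "int_congruent n G H \<longleftrightarrow>
     (\<exists>B \<in> carrier_mat n n. invertible_mat B \<and> H = transpose_mat B * G * B)"

lemma invertible_mat_obtain:
  fixes B :: "int mat"
  assumes "B \<in> carrier_mat n n" "invertible_mat B"
  obtains C where "C \<in> carrier_mat n n" "B * C = 1\<^sub>m n" "C * B = 1\<^sub>m n"
proof -
  obtain C where C: "B * C = 1\<^sub>m n" "C * B = 1\<^sub>m (dim_row C)"
    using assms unfolding invertible_mat_def inverts_mat_def by auto
  have "dim_col (B * C) = n" "dim_col (C * B) = dim_row C" unfolding C by simp_all
  then have "C \<in> carrier_mat n n" using assms(1) by auto
  then show ?thesis using that[of C] C by auto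
qed

lemma invertible_matI:
  assumes "B \<in> carrier_mat n n" "C \<in> carrier_mat n n" "B * C = 1\<^sub>m n" "C * B = 1\<^sub>m n"
  shows "invertible_mat B"
  using assms unfolding invertible_mat_def inverts_mat_def by auto

text \<open>The determinant is its own inverse, so multiplying the adjugate by it gives an integral
  inverse.\<close>

lemma invertible_mat_if_det_square:
  fixes B :: "int mat"
  assumes B: "B \<in> carrier_mat n n" and det: "det B * det B = 1"
  shows "invertible_mat B"
proof (rule invertible_matI[OF B])
  note adj = adj_mat[OF B]
  show "det B \<cdot>\<^sub>m adj_mat B \<in> carrier_mat n n" using adj(1) by simp
  have "x \<cdot>\<^sub>m (y \<cdot>\<^sub>m 1\<^sub>m n) = (x * y) \<cdot>\<^sub>m (1\<^sub>m n :: int mat)" for x y :: int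
    by (intro eq_matI) auto
  moreover have "1 \<cdot>\<^sub>m 1\<^sub>m n = (1\<^sub>m n :: int mat)"
    by (intro eq_matI) auto
  ultimately show "B * (det B \<cdot>\<^sub>m adj_mat B) = 1\<^sub>m n" "(det B \<cdot>\<^sub>m adj_mat B) * B = 1\<^sub>m n"
    using adj det B
    by (simp_all add: mult_smult_distrib[of _ n n _ n] mult_smult_assoc_mat[of _ n n _ n])
qed

text \<open>Determinants give \<open>det B * det B = 1\<close>, so for a concrete base change only
  the matrix identity has to be verified.\<close>

lemma int_congruent_if_det_one:
  assumes "G \<in> carrier_mat n n" "B \<in> carrier_mat n n" "det G = 1"
    and "det H = 1" "H = transpose_mat B * G * B"
  shows "int_congruent n G H"
proof -
  have "det H = det B * det B"
    unfolding assms(5) using assms(1-3)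
    by (simp add: det_mult[of _ n] det_transpose[of _ n] mult_carrier_mat[of _ n n _ n])
  then show ?thesis
    using assms invertible_mat_if_det_square[of B n] unfolding int_congruent_def by auto
qed

lemma transpose_congruence_mult:
  fixes G :: "int mat"
  assumes "G \<in> carrier_mat n n" "B \<in> carrier_mat n n" "C \<in> carrier_mat n n"
  shows "transpose_mat C * (transpose_mat B * G * B) * C = transpose_mat (B * C) * G * (B * C)"
  using assms
  by (simp add: transpose_mult[of _ n n _ n] assoc_mult_mat[of _ n n _ n _ n] mult_carrier_mat[of _ n n _ n])

lemma int_congruent_sym:
  assumes "G \<in> carrier_mat n n" "int_congruent n G H"
  shows "int_congruent n H G"
proof -
  obtain B where B: "B \<in> carrier_mat n n" "invertible_mat B" "H = transpose_mat B * G * B"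
    using assms(2) unfolding int_congruent_def by blast
  obtain C where C: "C \<in> carrier_mat n n" "B * C = 1\<^sub>m n" "C * B = 1\<^sub>m n"
    using invertible_mat_obtain[OF B(1,2)] .
  have "transpose_mat C * H * C = G"
    unfolding B(3) transpose_congruence_mult[OF assms(1) B(1) C(1)] C(2) using assms(1) by simp
  then show ?thesis
    using C B(1) invertible_matI[OF C(1) B(1)] unfolding int_congruent_def by auto
qed

lemma int_congruent_trans:
  assumes "G \<in> carrier_mat n n" "int_congruent n G H" "int_congruent n H K"
  shows "int_congruent n G K"
proof -
  obtain B where B: "B \<in> carrier_mat n n" "invertible_mat B" "H = transpose_mat B * G * B"
    using assms(2) unfolding int_congruent_def by blast
  obtain C where C: "C \<in> carrier_mat n n" "invertible_mat C" "K = transpose_mat C * H * C"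
    using assms(3) unfolding int_congruent_def by blast
  obtain B' where B': "B' \<in> carrier_mat n n" "B * B' = 1\<^sub>m n" "B' * B = 1\<^sub>m n"
    using invertible_mat_obtain[OF B(1,2)] .
  obtain C' where C': "C' \<in> carrier_mat n n" "C * C' = 1\<^sub>m n" "C' * C = 1\<^sub>m n"
    using invertible_mat_obtain[OF C(1,2)] .
  have cancel: "(X * Y) * (Y' * X') = 1\<^sub>m n"
    if "X \<in> carrier_mat n n" "Y \<in> carrier_mat n n" "Y' \<in> carrier_mat n n" "X' \<in> carrier_mat n n"
      "Y * Y' = 1\<^sub>m n" "X * X' = 1\<^sub>m n" for X Y Y' X' :: "int mat"
  proof -
    have "(X * Y) * (Y' * X') = X * ((Y * Y') * X')"
      using that(1-4) by (simp add: assoc_mult_mat[of _ n n _ n _ n] mult_carrier_mat[of _ n n _ n])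
    then show ?thesis using that by simp
  qed
  have "invertible_mat (B * C)"
    by (rule invertible_matI[of _ n "C' * B'"]) (use B C B' C' in \<open>auto intro!: cancel\<close>)
  then show ?thesis
    unfolding int_congruent_def C(3) B(3) transpose_congruence_mult[OF assms(1) B(1) C(1)]
    using B(1) C(1) by auto
qed

section \<open>Hurwitz moves as integral congruences\<close>

lemma congruence_index:
  assumes "B \<in> carrier_mat n n" "G \<in> carrier_mat n n" "k < n" "l < n"
  shows "(transpose_mat B * G * B) $$ (k, l) =
    (\<Sum>j<n. (\<Sum>i<n. B $$ (i, k) * G $$ (i, j)) * B $$ (j, l))"
proof -
  have BT: "transpose_mat B \<in> carrier_mat n n" using assms by simp
  have "(transpose_mat B * G * B) $$ (k, l) = (\<Sum>j<n. (transpose_mat B * G) $$ (k, j) * B $$ (j, l))"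
    using assms by (intro mat_mult_index[of _ n n _ n]) (auto intro!: mult_carrier_mat)
  also have "\<dots> = (\<Sum>j<n. (\<Sum>i<n. B $$ (i, k) * G $$ (i, j)) * B $$ (j, l))"
  proof (rule sum.cong)
    fix j assume "j \<in> {..<n}"
    then show "(transpose_mat B * G) $$ (k, j) * B $$ (j, l) =
        (\<Sum>i<n. B $$ (i, k) * G $$ (i, j)) * B $$ (j, l)"
      using mat_mult_index[OF BT assms(2,3), of j] assms by simp
  qed simp
  finally show ?thesis .
qed

text \<open>Reversing the arc negates its root; the base change is the diagonal sign matrix with
  \<open>- 1\<close> at the position \<open>length xs\<close> of that arc.\<close>

lemma int_congruent_arc_gram_flip:
  "int_congruent (length (xs @ (a, b) # ys)) (arc_gram (xs @ (a, b) # ys)) (arc_gram (xs @ (b, a) # ys))"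
proof -
  let ?ts = "xs @ (a, b) # ys" and ?us = "xs @ (b, a) # ys"
  define n where "n = length ?ts"
  define e :: "nat \<Rightarrow> int" where "e k = (if k = length xs then - 1 else 1)" for k
  define B where "B = mat n n (\<lambda>(i, k). if i = k then e k else 0)"
  have B: "B \<in> carrier_mat n n" by (simp add: B_def)
  have U: "arc_gram ?ts \<in> carrier_mat n n" unfolding n_def by (rule arc_gram_carrier)
  have len: "length ?ts = n" "length ?us = n" by (simp_all add: n_def)
  have inner: "arc_inner (?us ! k) (?us ! l) = e k * e l * arc_inner (?ts ! k) (?ts ! l)" for k l
    by (auto simp: e_def nth_append nth_Cons' arc_inner_def arc_vec_def)
  have col: "(\<Sum>i<n. B $$ (i, k) * f i) = e k * f k" if "k < n" for k f
  proof -
    have "(\<Sum>i<n. B $$ (i, k) * f i) = (\<Sum>i<n. if i = k then e k * f i else 0)"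
      using that by (intro sum.cong) (auto simp: B_def)
    then show ?thesis using that by simp
  qed
  have "arc_gram ?us = transpose_mat B * arc_gram ?ts * B"
  proof (rule eq_matI)
    fix k l assume "k < dim_row (transpose_mat B * arc_gram ?ts * B)"
      "l < dim_col (transpose_mat B * arc_gram ?ts * B)"
    then have kl: "k < n" "l < n" using B by auto
    have "(transpose_mat B * arc_gram ?ts * B) $$ (k, l) =
        (\<Sum>j<n. (\<Sum>i<n. B $$ (i, k) * arc_gram ?ts $$ (i, j)) * B $$ (j, l))"
      by (rule congruence_index[OF B U kl])
    also have "\<dots> = (\<Sum>j<n. B $$ (j, l) * (e k * arc_gram ?ts $$ (k, j)))"
      unfolding col[OF kl(1)] by (simp add: mult.commute)
    also have "\<dots> = e l * (e k * arc_gram ?ts $$ (k, l))"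
      by (rule col[OF kl(2)])
    also have "\<dots> = arc_gram ?us $$ (k, l)"
      unfolding arc_gram_index[of _ ?us, unfolded len, OF kl]
        arc_gram_index[of _ ?ts, unfolded len, OF kl] inner
      by (auto simp: e_def)
    finally show "arc_gram ?us $$ (k, l) = (transpose_mat B * arc_gram ?ts * B) $$ (k, l)" ..
  qed (use B len in auto)
  then show ?thesis
    unfolding len by (rule int_congruent_if_det_one[OF U B det_arc_gram det_arc_gram])
qed

text \<open>Renaming vertices by the transposition of \<open>p\<close> acts on vectors as the
  reflection in the root of \<open>p\<close>, which subtracts \<open>arc_inner p t\<close> times
  that root from the root of \<open>t\<close>.\<close>

lemma arc_inner_reflect:
  assumes "fst p \<noteq> snd p"
  shows "arc_inner x (reflect_arc p t) = arc_inner x t - arc_inner p t * arc_inner x p"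
proof -
  have *: "arc_vec x (transpose (fst p) (snd p) w) = arc_vec x w - arc_vec p w * arc_inner x p" for w
    using assms by (auto simp: arc_vec_def arc_inner_def transpose_def)
  have "arc_inner x (reflect_arc p t) = (arc_vec x (fst t) - arc_vec p (fst t) * arc_inner x p) -
      (arc_vec x (snd t) - arc_vec p (snd t) * arc_inner x p)"
    unfolding arc_inner_def[of x "reflect_arc p t"] by (simp add: reflect_arc_def *)
  then show ?thesis by (simp add: arc_inner_def[of x t] arc_inner_def[of p t] algebra_simps)
qed

lemma arc_inner_reflect_left:
  "fst p \<noteq> snd p \<Longrightarrow>
     arc_inner (reflect_arc p t) x = arc_inner x t - arc_inner p t * arc_inner x p"
  using arc_inner_reflect by (subst arc_inner_commute)

text \<open>The roots at positions \<open>m\<close> and \<open>Suc m\<close> change from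
  \<open>p, t\<close> to \<open>t - c p, p\<close>. The coefficient \<open>c = arc_inner p t\<close>
  also keeps the matrix upper triangular: the entry at \<open>(Suc m, m)\<close> becomes
  \<open>c - c * 1 = 0\<close>.\<close>

lemma int_congruent_arc_gram_move:
  assumes p: "fst p \<noteq> snd p"
  shows "int_congruent (length (xs @ p # t # ys)) (arc_gram (xs @ p # t # ys))
    (arc_gram (xs @ reflect_arc p t # p # ys))"
proof -
  let ?ts = "xs @ p # t # ys" and ?us = "xs @ reflect_arc p t # p # ys"
  define n where "n = length ?ts"
  define m where "m = length xs"
  define c where "c = arc_inner p t"
  \<comment> \<open>\<open>\<pi>\<close> exchanges the two positions, and \<open>d\<close> inserts
    the correction \<open>- c\<close> into column \<open>m\<close> of \<open>B\<close>.\<close>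
  define \<pi> where "\<pi> k = transpose m (Suc m) k" for k
  define d :: "nat \<Rightarrow> int" where "d k = (if k = m then c else 0)" for k
  define B where "B = mat n n (\<lambda>(i, k). (if i = \<pi> k then 1 else 0) - (if i = m then d k else 0))"
  let ?U = "\<lambda>i j. arc_gram ?ts $$ (i, j)"
  have B: "B \<in> carrier_mat n n" by (simp add: B_def)
  have U: "arc_gram ?ts \<in> carrier_mat n n" unfolding n_def by (rule arc_gram_carrier)
  have len: "length ?ts = n" "length ?us = n" by (simp_all add: n_def)
  have mn: "m < n" "Suc m < n" by (auto simp: m_def n_def)
  have \<pi>: "\<pi> k < n" if "k < n" for k using that mn by (auto simp: \<pi>_def transpose_def)
  have col: "(\<Sum>i<n. B $$ (i, k) * f i) = f (\<pi> k) - d k * f m" if "k < n" for k f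
  proof -
    have "(\<Sum>i<n. B $$ (i, k) * f i) =
        (\<Sum>i<n. if i = \<pi> k then f i else 0) - (\<Sum>i<n. if i = m then d k * f i else 0)"
      unfolding sum_subtractf[symmetric] using that by (intro sum.cong) (auto simp: B_def algebra_simps)
    then show ?thesis using \<pi>[OF that] mn by simp
  qed
  have nth: "?ts ! m = p" "?ts ! Suc m = t" "?us ! m = reflect_arc p t" "?us ! Suc m = p"
    by (simp_all add: m_def nth_append)
  have nth_other: "?us ! k = ?ts ! k" if "k \<noteq> m" "k \<noteq> Suc m" for k
    using that by (auto simp: m_def nth_append nth_Cons')
  have "arc_gram ?us = transpose_mat B * arc_gram ?ts * B"
  proof (rule eq_matI)
    fix k l assume "k < dim_row (transpose_mat B * arc_gram ?ts * B)"
      "l < dim_col (transpose_mat B * arc_gram ?ts * B)"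
    then have kl: "k < n" "l < n" using B by auto
    have "(transpose_mat B * arc_gram ?ts * B) $$ (k, l) =
        (\<Sum>j<n. (\<Sum>i<n. B $$ (i, k) * ?U i j) * B $$ (j, l))"
      by (rule congruence_index[OF B U kl])
    also have "\<dots> = (\<Sum>j<n. B $$ (j, l) * (?U (\<pi> k) j - d k * ?U m j))"
      unfolding col[OF kl(1)] by (simp add: mult.commute)
    also have "\<dots> = (?U (\<pi> k) (\<pi> l) - d k * ?U m (\<pi> l)) - d l * (?U (\<pi> k) m - d k * ?U m m)"
      by (rule col[OF kl(2)])
    also have "\<dots> = arc_gram ?us $$ (k, l)"
    proof -
      consider "k = m" | "k = Suc m" | "k < m" | "k > Suc m" by linarith
      note k_cases = this
      consider "l = m" | "l = Suc m" | "l < m" | "l > Suc m" by linarith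
      then show ?thesis
        unfolding arc_gram_index[of _ ?us, unfolded len, OF kl]
          arc_gram_index[of _ ?ts, unfolded len, OF \<pi>[OF kl(1)] \<pi>[OF kl(2)]]
          arc_gram_index[of _ ?ts, unfolded len, OF mn(1) \<pi>[OF kl(2)]]
          arc_gram_index[of _ ?ts, unfolded len, OF \<pi>[OF kl(1)] mn(1)]
          arc_gram_index[of _ ?ts, unfolded len, OF mn(1) mn(1)]
        by (cases rule: k_cases; cases)
          (simp_all add: \<pi>_def d_def nth nth_other c_def arc_inner_reflect[OF p]
            arc_inner_reflect_left[OF p] arc_inner_self[OF p] arc_inner_commute algebra_simps)
    qed
    finally show "arc_gram ?us $$ (k, l) = (transpose_mat B * arc_gram ?ts * B) $$ (k, l)" ..
  qed (use B len in auto)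
  then show ?thesis
    unfolding len by (rule int_congruent_if_det_one[OF U B det_arc_gram det_arc_gram])
qed

text \<open>Each generator is a base change, and integral congruence is an equivalence relation.
  Membership in \<open>arcs UNIV\<close> just excludes loops, whose root is zero and admits no
  reflection.\<close>

lemma hurwitz_eq_int_congruent:
  assumes "ts \<simeq> us" "set ts \<subseteq> arcs UNIV"
  shows "int_congruent (length ts) (arc_gram ts) (arc_gram us)"
  using assms
proof induction
  case (hurwitz_refl ts)
  show ?case
    unfolding int_congruent_def
    by (rule bexI[of _ "1\<^sub>m (length ts)"])
      (auto intro!: invertible_matI[of _ "length ts" "1\<^sub>m (length ts)"] simp: arc_gram_def)
next
  case (hurwitz_sym ts us)
  note eq = hurwitz_eq_length[OF hurwitz_sym(1)] hurwitz_eq_arcs[OF hurwitz_sym(1), of UNIV]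
  have "int_congruent (length us) (arc_gram ts) (arc_gram us)"
    using hurwitz_sym eq by simp
  then show ?case by (rule int_congruent_sym[rotated]) (use eq in \<open>simp add: arc_gram_def\<close>)
next
  case (hurwitz_trans ts us ws)
  note eq = hurwitz_eq_length[OF hurwitz_trans(1)] hurwitz_eq_arcs[OF hurwitz_trans(1), of UNIV]
  have "int_congruent (length ts) (arc_gram ts) (arc_gram us)"
    "int_congruent (length ts) (arc_gram us) (arc_gram ws)"
    using hurwitz_trans(3,4,5) eq by simp_all
  then show ?case by (rule int_congruent_trans[OF arc_gram_carrier])
next
  case (hurwitz_flip xs a b ys)
  show ?case by (rule int_congruent_arc_gram_flip)
next
  case (hurwitz_move xs p t ys)
  then have "fst p \<noteq> snd p" by (auto simp: arcs_def)
  then show ?case by (rule int_congruent_arc_gram_move)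
qed

subsection \<open>Forms of Dynkin type A\<close>

text \<open>From \<open>H = B^T G B\<close> one gets \<open>H^T H^-1 = B^T (G^T G^-1) B^-T\<close>,
  a conjugation by \<open>B^T\<close>.\<close>

lemma similar_coxeter:
  fixes G H :: "int mat"
  assumes G: "G \<in> carrier_mat n n" "det G = 1" and H: "H \<in> carrier_mat n n" "det H = 1"
    and cong: "int_congruent n G H"
  shows "char_poly (- (transpose_mat G * int_mat_inverse G)) =
    char_poly (- (transpose_mat H * int_mat_inverse H))"
proof -
  obtain B where B: "B \<in> carrier_mat n n" "invertible_mat B" "H = transpose_mat B * G * B"
    using cong unfolding int_congruent_def by blast
  obtain C where C: "C \<in> carrier_mat n n" "B * C = 1\<^sub>m n" "C * B = 1\<^sub>m n"
    using invertible_mat_obtain[OF B(1,2)] .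
  let ?BT = "transpose_mat B" and ?CT = "transpose_mat C" and ?GT = "transpose_mat G"
  have BCT: "?BT * ?CT = 1\<^sub>m n" "?CT * ?BT = 1\<^sub>m n"
    unfolding transpose_mult[OF C(1) B(1), symmetric] transpose_mult[OF B(1) C(1), symmetric]
    using C by simp_all
  note IG = int_mat_inverse[OF G] and IH = int_mat_inverse[OF H]
  let ?X = "C * int_mat_inverse G * ?CT"
  note assoc = assoc_mult_mat[of _ n n _ n _ n] mult_carrier_mat[of _ n n _ n]
  have cancel: "X * (Y * Z) = Z" if "X * Y = 1\<^sub>m n" "X \<in> carrier_mat n n" "Y \<in> carrier_mat n n"
    "Z \<in> carrier_mat n n" for X Y Z :: "int mat"
    using that assoc_mult_mat[OF that(2-4)] by simp
  have X: "?X \<in> carrier_mat n n" using C IG by (simp add: assoc)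
  have "H * ?X = ?BT * (G * (B * (C * (int_mat_inverse G * ?CT))))"
    unfolding B(3) using B(1) C(1) G(1) IG(1) by (simp add: assoc)
  also have "\<dots> = 1\<^sub>m n"
    using B(1) C(1) G(1) IG(1) by (simp add: cancel[OF C(2)] cancel[OF IG(2)] BCT assoc)
  finally have HX: "H * ?X = 1\<^sub>m n" .
  have "int_mat_inverse H = int_mat_inverse H * (H * ?X)" using HX IH by simp
  also have "\<dots> = ?X" by (rule cancel[OF IH(3,1) H(1) X])
  finally have inv: "int_mat_inverse H = ?X" .
  have "transpose_mat H * int_mat_inverse H = ?BT * (?GT * (B * (C * (int_mat_inverse G * ?CT))))"
    unfolding inv unfolding B(3) using B(1) C(1) G(1) IG(1)
    by (simp add: assoc transpose_mult[of _ n n _ n])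
  also have "\<dots> = ?BT * (?GT * int_mat_inverse G) * ?CT"
    using B(1) C(1) G(1) IG(1) by (simp add: cancel[OF C(2)] assoc)
  finally have "- (transpose_mat H * int_mat_inverse H) = ?BT * - (?GT * int_mat_inverse G) * ?CT"
    using B(1) C(1) G(1) IG(1) by (simp add: assoc)
  then have "similar_mat_wit (- (transpose_mat H * int_mat_inverse H))
      (- (?GT * int_mat_inverse G)) ?BT ?CT"
    using BCT B(1) C(1) G(1) H(1) IG(1) IH(1) by (intro similar_mat_witI[of _ _ n]) (auto simp: assoc)
  then show ?thesis using char_poly_similar unfolding similar_mat_def by metis
qed

text \<open>A nonzero vector with coordinate sum 0 has a positive and a negative entry. Each
  contributes at least 1 to the sum of squares, so they are 1 and -1 and nothing is left for the
  other entries.\<close>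

lemma sum_squares_two_arc:
  fixes f :: "'a \<Rightarrow> int"
  assumes A: "finite A" and sq: "(\<Sum>k\<in>A. (f k)\<^sup>2) = 2" and sum: "(\<Sum>k\<in>A. f k) = 0"
  obtains t where "t \<in> arcs A" "\<And>k. k \<in> A \<Longrightarrow> f k = arc_vec t k"
proof -
  have nz: "\<not> (\<forall>k\<in>A. f k = 0)"
  proof
    assume "\<forall>k\<in>A. f k = 0"
    then have "(\<Sum>k\<in>A. (f k)\<^sup>2) = 0" by (intro sum.neutral) auto
    then show False using sq by simp
  qed
  have "\<not> (\<forall>k\<in>A. 0 \<le> - f k)"
    using nz sum sum_nonneg_eq_0_iff[OF A, of "\<lambda>k. - f k"] by (auto simp: sum_negf)
  then obtain a where a: "a \<in> A" "f a > 0" by auto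
  have "\<not> (\<forall>k\<in>A. 0 \<le> f k)"
    using nz sum sum_nonneg_eq_0_iff[OF A, of f] by auto
  then obtain b where b: "b \<in> A" "f b < 0" by (auto simp: not_le)
  have ab: "a \<noteq> b" using a b by auto
  have "(\<Sum>k\<in>A. (f k)\<^sup>2) = (f a)\<^sup>2 + ((f b)\<^sup>2 + (\<Sum>k\<in>A - {a} - {b}. (f k)\<^sup>2))"
    using A a b ab by (simp add: sum.remove[of A a] sum.remove[of "A - {a}" b])
  moreover have "f a \<le> (f a)\<^sup>2" using a(2) self_le_power[of "f a" 2] by simp
  moreover have "- f b \<le> (f b)\<^sup>2" using b(2) self_le_power[of "- f b" 2] by simp
  moreover have "(\<Sum>k\<in>A - {a} - {b}. (f k)\<^sup>2) \<ge> 0" by (intro sum_nonneg) simp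
  ultimately have "f a = 1" "f b = - 1" "(\<Sum>k\<in>A - {a} - {b}. (f k)\<^sup>2) = 0"
    using a(2) b(2) sq by linarith+
  moreover from this(3) have "\<forall>k\<in>A - {a} - {b}. f k = 0"
    using sum_nonneg_eq_0_iff[of "A - {a} - {b}" "\<lambda>k. (f k)\<^sup>2"] A by simp
  ultimately have "f k = arc_vec (a, b) k" if "k \<in> A" for k
    using that ab by (cases "k = a \<or> k = b") (auto simp: arc_vec_def)
  then show ?thesis using that[of "(a, b)"] a b ab by (simp add: arcs_def)
qed

text \<open>Only additivity is available, so negative multiples are handled through
  \<open>c e_i + (-c) e_i = 0\<close>, and the vector is built up coordinate by coordinate.\<close>

lemma additive_eq_0_if_unit_vecs:
  fixes \<phi> :: "int vec \<Rightarrow> int"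
  assumes add: "\<And>x y. x \<in> carrier_vec n \<Longrightarrow> y \<in> carrier_vec n \<Longrightarrow> \<phi> (x + y) = \<phi> x + \<phi> y"
    and unit: "\<And>i. i < n \<Longrightarrow> \<phi> (unit_vec n i) = 0" and x: "x \<in> carrier_vec n"
  shows "\<phi> x = 0"
proof -
  have zero: "\<phi> (0\<^sub>v n) = 0" using add[of "0\<^sub>v n" "0\<^sub>v n"] by simp
  have nat: "\<phi> (int m \<cdot>\<^sub>v unit_vec n i) = 0" if "i < n" for m i
  proof (induction m)
    case 0
    have "int 0 \<cdot>\<^sub>v unit_vec n i = 0\<^sub>v n" by (rule eq_vecI) auto
    then show ?case using zero by simp
  next
    case (Suc m)
    have "int (Suc m) \<cdot>\<^sub>v unit_vec n i = int m \<cdot>\<^sub>v unit_vec n i + unit_vec n i"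
      by (rule eq_vecI) (auto simp: algebra_simps)
    then show ?case using Suc add[of "int m \<cdot>\<^sub>v unit_vec n i" "unit_vec n i"] unit[OF that] by simp
  qed
  have int: "\<phi> (c \<cdot>\<^sub>v unit_vec n i) = 0" if "i < n" for c i
  proof (cases "c \<ge> 0")
    case True
    then show ?thesis using nat[OF that, of "nat c"] by simp
  next
    case False
    have "c \<cdot>\<^sub>v unit_vec n i + int (nat (- c)) \<cdot>\<^sub>v unit_vec n i = 0\<^sub>v n"
      using False by (intro eq_vecI) auto
    then show ?thesis
      using add[of "c \<cdot>\<^sub>v unit_vec n i" "int (nat (- c)) \<cdot>\<^sub>v unit_vec n i"] zero nat[OF that, of "nat (- c)"]
      by simp
  qed
  have "m \<le> n \<Longrightarrow> \<phi> (vec n (\<lambda>i. if i < m then x $ i else 0)) = 0" for m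
  proof (induction m)
    case 0
    have "vec n (\<lambda>i. if i < 0 then x $ i else 0) = 0\<^sub>v n" by (rule eq_vecI) auto
    then show ?case using zero by simp
  next
    case (Suc m)
    have "vec n (\<lambda>i. if i < Suc m then x $ i else 0) =
        vec n (\<lambda>i. if i < m then x $ i else 0) + x $ m \<cdot>\<^sub>v unit_vec n m"
      using Suc.prems by (intro eq_vecI) (auto simp: less_Suc_eq)
    then show ?case
      using Suc add[of "vec n (\<lambda>i. if i < m then x $ i else 0)" "x $ m \<cdot>\<^sub>v unit_vec n m"] int[of m "x $ m"]
      by simp
  qed
  from this[of n] have "\<phi> (vec n (\<lambda>i. if i < n then x $ i else 0)) = 0" by simp
  moreover have "vec n (\<lambda>i. if i < n then x $ i else 0) = x" using x by (intro eq_vecI) auto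
  ultimately show ?thesis by simp
qed

text \<open>The embedding of the root lattice into \<open>Z^(r+1)\<close>: \<open>z\<close> holds
  the coefficients with respect to the simple roots \<open>e_i - e_(i+1)\<close>.\<close>

definition root_coords :: "nat \<Rightarrow> int vec \<Rightarrow> nat \<Rightarrow> int" where
  "root_coords r z k = (\<Sum>i<r. arc_vec (i, Suc i) k * z $ i)"

lemma sum_root_coords: "(\<Sum>k<Suc r. root_coords r z k) = 0"
proof -
  have "(\<Sum>k<Suc r. root_coords r z k) = (\<Sum>i<r. (\<Sum>k<Suc r. 1 * arc_vec (i, Suc i) k) * z $ i)"
    unfolding root_coords_def by (subst sum.swap) (simp add: sum_distrib_right del: sum.lessThan_Suc)
  also have "\<dots> = 0" by (intro sum.neutral ballI, subst sum_arc_vec) auto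
  finally show ?thesis .
qed

text \<open>The Gram matrix of the simple roots is the Cartan matrix
  \<open>2 Id - Adj\<close>.\<close>

lemma sum_root_coords_square:
  assumes z: "z \<in> carrier_vec r"
  shows "(\<Sum>k<Suc r. (root_coords r z k)\<^sup>2) = 2 * dynkin_form (Dyn_A r) z"
proof -
  let ?S = "2 \<cdot>\<^sub>m 1\<^sub>m r - dynkin_adj (Dyn_A r)"
  have S: "?S \<in> carrier_mat r r" by (rule carrier_matI) (simp_all add: dynkin_adj_def)
  have inner: "?S $$ (i, j) = (\<Sum>k<Suc r. arc_vec (i, Suc i) k * arc_vec (j, Suc j) k)"
    if "i < r" "j < r" for i j
    using that by (subst sum_arc_vec) (auto simp: dynkin_adj_def arc_vec_def)
  have "(\<Sum>k<Suc r. (root_coords r z k)\<^sup>2) =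
      (\<Sum>k<Suc r. \<Sum>i<r. \<Sum>j<r. (arc_vec (i, Suc i) k * arc_vec (j, Suc j) k) * (z $ i * z $ j))"
    unfolding root_coords_def power2_eq_square sum_product by (simp add: mult_ac del: sum.lessThan_Suc)
  also have "\<dots> = (\<Sum>i<r. \<Sum>k<Suc r. \<Sum>j<r. (arc_vec (i, Suc i) k * arc_vec (j, Suc j) k) * (z $ i * z $ j))"
    by (rule sum.swap)
  also have "\<dots> = (\<Sum>i<r. \<Sum>j<r. \<Sum>k<Suc r. (arc_vec (i, Suc i) k * arc_vec (j, Suc j) k) * (z $ i * z $ j))"
    by (intro sum.cong refl sum.swap)
  also have "\<dots> = (\<Sum>i<r. \<Sum>j<r. ?S $$ (i, j) * (z $ i * z $ j))"
    by (intro sum.cong refl) (simp only: inner lessThan_iff sum_distrib_right)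
  also have "\<dots> = z \<bullet> (?S *\<^sub>v z)" by (rule quad_mat_expand[OF S z z, symmetric])
  finally have eq: "(\<Sum>k<Suc r. (root_coords r z k)\<^sup>2) = z \<bullet> (?S *\<^sub>v z)" .
  \<comment> \<open>\<open>dynkin_form\<close> divides by 2 with \<open>div\<close>, so evenness
    must be shown: squares agree with the coordinates modulo 2, and these sum to 0.\<close>
  have "even (\<Sum>k<Suc r. (root_coords r z k)\<^sup>2 - root_coords r z k)"
    by (intro dvd_sum) simp
  then have "even (\<Sum>k<Suc r. (root_coords r z k)\<^sup>2)"
    unfolding sum_subtractf sum_root_coords by (simp del: sum.lessThan_Suc)
  then show ?thesis unfolding dynkin_form_def using eq by (simp del: sum.lessThan_Suc)
qed

lemma root_coords_add:
  assumes "x \<in> carrier_vec r" "y \<in> carrier_vec r"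
  shows "root_coords r (x + y) k = root_coords r x k + root_coords r y k"
  using assms by (simp add: root_coords_def sum.distrib distrib_left)

lemma root_coords_unit_vec:
  assumes "i < r"
  shows "root_coords r (unit_vec r i) k = arc_vec (i, Suc i) k"
proof -
  have "root_coords r (unit_vec r i) k = (\<Sum>j<r. if j = i then arc_vec (i, Suc i) k else 0)"
    unfolding root_coords_def using assms by (intro sum.cong) auto
  then show ?thesis using assms by simp
qed

text \<open>\<open>w\<close> composes the projection to the radical quotient, the isomorphism
  \<open>h\<close> and the embedding \<open>root_coords\<close>. Surjectivity onto the root lattice
  is recorded on the simple roots, which generate it.\<close>

lemma dynkin_A_coordinates:
  assumes iq: "integral_quadratic_form n q" and type: "has_dynkin_type n q (Dyn_A r)"
  shows "\<exists>w :: int vec \<Rightarrow> nat \<Rightarrow> int.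
    (\<forall>x \<in> carrier_vec n. (\<Sum>k<Suc r. (w x k)\<^sup>2) = 2 * q x) \<and>
    (\<forall>x \<in> carrier_vec n. (\<Sum>k<Suc r. w x k) = 0) \<and>
    (\<forall>x \<in> carrier_vec n. \<forall>y \<in> carrier_vec n. \<forall>k. w (x + y) k = w x k + w y k) \<and>
    (\<forall>i<r. \<exists>x \<in> carrier_vec n. w x = arc_vec (i, Suc i))"
proof -
  let ?V = "monoid_vec TYPE(int) n" and ?K = "mat_kernel (gram_mat n q)"
  obtain h where h: "h \<in> iso (radical_quotient n q) (monoid_vec TYPE(int) r)"
    and val: "\<forall>C \<in> carrier (radical_quotient n q). dynkin_form (Dyn_A r) (h C) = induced_form q C"
    using type unfolding has_dynkin_type_def by auto
  interpret V: comm_group ?V by (rule comm_group_vec)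
  have gram: "gram_mat n q \<in> carrier_mat n n" by (simp add: gram_mat_def)
  have sub: "subgroup ?K ?V"
  proof
    fix x y assume xy: "x \<in> ?K" "y \<in> ?K"
    show "x \<otimes>\<^bsub>?V\<^esub> y \<in> ?K"
      using xy gram by (auto simp: monoid_vec_simps mat_kernel[OF gram] mult_add_distrib_mat_vec[of _ n n])
  next
    fix x assume x: "x \<in> ?K"
    then have xc: "x \<in> carrier_vec n" by (simp add: mat_kernel[OF gram])
    have "inv\<^bsub>?V\<^esub> x = - x"
      by (rule V.inv_equality) (use xc in \<open>auto simp: monoid_vec_simps\<close>)
    moreover have "- x \<in> ?K"
    proof -
      have "gram_mat n q *\<^sub>v (- x) = - (gram_mat n q *\<^sub>v x)"
        using gram xc by (intro eq_vecI) auto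
      then show ?thesis using x xc by (auto simp: mat_kernel[OF gram])
    qed
    ultimately show "inv\<^bsub>?V\<^esub> x \<in> ?K" by simp
  qed (use gram in \<open>auto simp: monoid_vec_simps mat_kernel[OF gram]\<close>)
  interpret K: normal ?K ?V using V.normal_iff_subgroup sub by blast
  define H where "H x = h (?K #>\<^bsub>?V\<^esub> x)" for x
  have coset: "?K #>\<^bsub>?V\<^esub> x \<in> carrier (radical_quotient n q)" if "x \<in> carrier_vec n" for x
    using that by (auto simp: radical_quotient_def FactGroup_def RCOSETS_def monoid_vec_simps)
  have H_closed: "H x \<in> carrier_vec r" if "x \<in> carrier_vec n" for x
    using h coset[OF that] unfolding H_def iso_def hom_def by (auto simp: monoid_vec_simps)
  have H_add: "H (x + y) = H x + H y" if "x \<in> carrier_vec n" "y \<in> carrier_vec n" for x y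
  proof -
    have "?K #>\<^bsub>?V\<^esub> (x + y) = (?K #>\<^bsub>?V\<^esub> x) \<otimes>\<^bsub>radical_quotient n q\<^esub> (?K #>\<^bsub>?V\<^esub> y)"
      using K.rcos_sum[of x y] that by (simp add: radical_quotient_def FactGroup_def monoid_vec_simps)
    then show ?thesis
      using h coset[OF that(1)] coset[OF that(2)] unfolding H_def iso_def hom_def
      by (auto simp: monoid_vec_simps)
  qed
  have H_surj: "\<exists>x \<in> carrier_vec n. H x = z" if "z \<in> carrier_vec r" for z
  proof -
    have "z \<in> h ` carrier (radical_quotient n q)"
      using h that unfolding iso_def bij_betw_def by (auto simp: monoid_vec_simps)
    then show ?thesis
      by (auto simp: H_def radical_quotient_def FactGroup_def RCOSETS_def monoid_vec_simps)
  qed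
  have H_val: "dynkin_form (Dyn_A r) (H x) = q x" if "x \<in> carrier_vec n" for x
    using val coset[OF that] induced_form_rcoset[OF iq that] by (simp add: H_def)
  show ?thesis
  proof (intro exI[of _ "\<lambda>x. root_coords r (H x)"] conjI ballI allI impI)
    show "(\<Sum>k<Suc r. (root_coords r (H x) k)\<^sup>2) = 2 * q x" if "x \<in> carrier_vec n" for x
      using sum_root_coords_square[OF H_closed[OF that]] H_val[OF that] by simp
    show "root_coords r (H (x + y)) k = root_coords r (H x) k + root_coords r (H y) k"
      if "x \<in> carrier_vec n" "y \<in> carrier_vec n" for x y k
      using that by (simp add: H_add root_coords_add H_closed)
    show "\<exists>x \<in> carrier_vec n. root_coords r (H x) = arc_vec (i, Suc i)" if "i < r" for i
    proof -
      obtain x where "x \<in> carrier_vec n" "H x = unit_vec r i" using H_surj[of "unit_vec r i"] by auto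
      moreover have "root_coords r (unit_vec r i) = arc_vec (i, Suc i)"
        using root_coords_unit_vec[OF that] by (rule ext)
      ultimately show ?thesis by (intro bexI[of _ x]) simp_all
    qed
  qed (rule sum_root_coords)
qed

section \<open>The arc list of a form\<close>

lemma upper_gram_mat_eqI:
  assumes u: "unit_form n q" and len: "length ts = n"
    and pol: "\<And>i j. i < j \<Longrightarrow> j < n \<Longrightarrow>
      polarization q (unit_vec n i) (unit_vec n j) = arc_inner (ts ! i) (ts ! j)"
  shows "upper_gram_mat n q = arc_gram ts"
proof -
  let ?G = "upper_gram_mat n q"
  have iq: "integral_quadratic_form n q" using u by (simp add: unit_form_def)
  note G = upper_gram_mat[OF iq]
  have GG: "gram_mat n q = ?G + transpose_mat ?G"
    by (rule gram_mat_quad_mat) (use G in auto)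
  have low: "?G $$ (i, j) = 0" if "j < i" "i < n" for i j
    using that G(1,2) unfolding upper_triangular_def by auto
  show ?thesis
  proof (rule eq_matI)
    fix i j assume "i < dim_row (arc_gram ts)" "j < dim_col (arc_gram ts)"
    then have ij: "i < n" "j < n" using len by auto
    consider "i = j" | "i < j" | "j < i" by linarith
    then show "?G $$ (i, j) = arc_gram ts $$ (i, j)"
    proof cases
      case 1
      have "1 = unit_vec n i \<bullet> (?G *\<^sub>v unit_vec n i)"
        using u ij G(3)[of "unit_vec n i"] by (simp add: unit_form_def)
      also have "\<dots> = ?G $$ (i, i)"
        using G(1) ij by (subst scalar_prod_left_unit[of _ n]) (auto intro!: mult_mat_vec_carrier[of _ n n])
      finally show ?thesis using 1 ij len by (simp add: arc_gram_index)
    next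
      case 2
      have "gram_mat n q $$ (i, j) = ?G $$ (i, j)" unfolding GG using ij G(1) low[OF 2 ij(2)] by simp
      then have "?G $$ (i, j) = arc_inner (ts ! i) (ts ! j)"
        using pol[OF 2 ij(2)] ij by (simp add: gram_mat_def)
      then show ?thesis using 2 ij len by (simp add: arc_gram_index)
    next
      case 3
      then show ?thesis using low[of j i] ij len by (simp add: arc_gram_index)
    qed
  qed (use G(1) len in auto)
qed

text \<open>Unit vectors have value 1, so their coordinates have squared length 2 and sum 0, hence
  are roots. Polarization matches the inner products of these roots, and surjectivity onto the root
  lattice gives connectedness.\<close>

lemma dynkin_A_arcs:
  assumes u: "unit_form n q" and type: "has_dynkin_type n q (Dyn_A r)"
  obtains ts where "length ts = n" "set ts \<subseteq> arcs {..<Suc r}" "arcs_connected {..<Suc r} ts"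
    "upper_gram_mat n q = arc_gram ts"
proof -
  let ?N = "{..<Suc r}" and ?e = "unit_vec n :: nat \<Rightarrow> int vec"
  have iq: "integral_quadratic_form n q" using u by (simp add: unit_form_def)
  obtain w :: "int vec \<Rightarrow> nat \<Rightarrow> int" where
    w_sq: "\<forall>x \<in> carrier_vec n. (\<Sum>k\<in>?N. (w x k)\<^sup>2) = 2 * q x" and
    w_sum: "\<forall>x \<in> carrier_vec n. (\<Sum>k\<in>?N. w x k) = 0" and
    w_add: "\<forall>x \<in> carrier_vec n. \<forall>y \<in> carrier_vec n. \<forall>k. w (x + y) k = w x k + w y k" and
    w_surj: "\<forall>i<r. \<exists>x \<in> carrier_vec n. w x = arc_vec (i, Suc i)"
    using dynkin_A_coordinates[OF iq type] by metis
  have "\<exists>t. t \<in> arcs ?N \<and> (\<forall>k\<in>?N. w (?e i) k = arc_vec t k)" if i: "i < n" for i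
  proof -
    have "(\<Sum>k\<in>?N. (w (?e i) k)\<^sup>2) = 2" "(\<Sum>k\<in>?N. w (?e i) k) = 0"
      using w_sq w_sum u i unfolding unit_form_def by auto
    then obtain t where "t \<in> arcs ?N" "\<And>k. k \<in> ?N \<Longrightarrow> w (?e i) k = arc_vec t k"
      using sum_squares_two_arc[of ?N "w (?e i)"] by blast
    then show ?thesis by blast
  qed
  then obtain \<tau> where \<tau>: "\<And>i. i < n \<Longrightarrow> \<tau> i \<in> arcs ?N"
    and w_\<tau>: "\<And>i k. i < n \<Longrightarrow> k \<in> ?N \<Longrightarrow> w (?e i) k = arc_vec (\<tau> i) k" by metis
  define ts where "ts = map \<tau> [0..<n]"
  have len: "length ts = n" and nth: "\<And>i. i < n \<Longrightarrow> ts ! i = \<tau> i" by (simp_all add: ts_def)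
  have set_ts: "set ts \<subseteq> arcs ?N" using \<tau> by (auto simp: ts_def)
  have pol: "polarization q (?e i) (?e j) = arc_inner (ts ! i) (ts ! j)" if ij: "i < n" "j < n" for i j
  proof -
    \<comment> \<open>The factor 2 comes from the normalization: the squared length of the
      coordinates is \<open>2 * q\<close>.\<close>
    have "2 * polarization q (?e i) (?e j) =
        (\<Sum>k\<in>?N. (w (?e i + ?e j) k)\<^sup>2) - (\<Sum>k\<in>?N. (w (?e i) k)\<^sup>2) - (\<Sum>k\<in>?N. (w (?e j) k)\<^sup>2)"
      by (simp add: polarization_def w_sq del: sum.lessThan_Suc)
    also have "\<dots> = (\<Sum>k\<in>?N. 2 * (w (?e i) k * w (?e j) k))"
      unfolding sum_subtractf[symmetric] by (intro sum.cong) (auto simp: w_add power2_sum)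
    also have "\<dots> = 2 * (\<Sum>k\<in>?N. arc_vec (\<tau> i) k * arc_vec (\<tau> j) k)"
      unfolding sum_distrib_left using ij by (intro sum.cong) (simp_all add: w_\<tau>)
    also have "(\<Sum>k\<in>?N. arc_vec (\<tau> i) k * arc_vec (\<tau> j) k) = arc_inner (\<tau> i) (\<tau> j)"
      using \<tau>[OF ij(2)] unfolding arc_inner_def by (intro sum_arc_vec) (auto simp: arcs_def)
    finally show ?thesis using ij by (simp add: nth)
  qed
  have "arcs_connected ?N ts"
    unfolding arcs_connected_def
  proof (intro allI impI)
    fix C assume C: "C \<subseteq> ?N" "\<forall>(a, b) \<in> set ts. a \<in> C \<longleftrightarrow> b \<in> C"
    have finC: "finite C" using C(1) finite_subset by blast
    have sumC: "(\<Sum>k\<in>C. arc_vec (a, b) k) = of_bool (a \<in> C) - of_bool (b \<in> C)" for a b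
      using finC by (simp add: arc_vec_def sum_subtractf of_bool_def)
    \<comment> \<open>The coordinate sum over \<open>C\<close> kills every root of the list, as
      \<open>C\<close> is closed under the arcs. Being additive, it vanishes everywhere, in
      particular on preimages of the simple roots, which links \<open>i\<close> to
      \<open>Suc i\<close>.\<close>
    have \<phi>: "(\<Sum>k\<in>C. w x k) = 0" if "x \<in> carrier_vec n" for x
    proof (rule additive_eq_0_if_unit_vecs[OF _ _ that])
      show "(\<Sum>k\<in>C. w (x + y) k) = (\<Sum>k\<in>C. w x k) + (\<Sum>k\<in>C. w y k)"
        if "x \<in> carrier_vec n" "y \<in> carrier_vec n" for x y
        using that by (simp add: w_add sum.distrib)
      show "(\<Sum>k\<in>C. w (?e i) k) = 0" if "i < n" for i
      proof -
        obtain a b where ab: "\<tau> i = (a, b)" by (cases "\<tau> i")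
        have "(a, b) \<in> set ts" using that ab by (force simp: ts_def)
        then have "a \<in> C \<longleftrightarrow> b \<in> C" using C(2) by blast
        moreover have "(\<Sum>k\<in>C. w (?e i) k) = (\<Sum>k\<in>C. arc_vec (a, b) k)"
          using C(1) that w_\<tau> ab by (intro sum.cong) auto
        ultimately show ?thesis by (simp add: sumC)
      qed
    qed
    have step: "i \<in> C \<longleftrightarrow> Suc i \<in> C" if i: "i < r" for i
    proof -
      obtain x where "x \<in> carrier_vec n" "w x = arc_vec (i, Suc i)" using w_surj i by blast
      then have "of_bool (i \<in> C) - of_bool (Suc i \<in> C) = (0 :: int)" using \<phi>[of x] sumC by simp
      then show ?thesis by (simp add: of_bool_def split: if_splits)
    qed
    have const: "i \<le> r \<Longrightarrow> i \<in> C \<longleftrightarrow> 0 \<in> C" for i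
    proof (induction i)
      case (Suc i)
      then show ?case using step[of i] by simp
    qed simp
    show "C = {} \<or> C = ?N"
    proof (cases "0 \<in> C")
      case True
      have "i \<in> C" if "i \<in> ?N" for i using const[of i] True that by auto
      then have "?N \<subseteq> C" by blast
      then show ?thesis using C(1) by simp
    next
      case False
      have "x \<notin> C" for x
      proof
        assume "x \<in> C"
        then show False using const[of x] C(1) False by auto
      qed
      then show ?thesis by blast
    qed
  qed
  moreover have "upper_gram_mat n q = arc_gram ts"
    by (rule upper_gram_mat_eqI[OF u len]) (simp add: pol)
  ultimately show thesis using that[of ts] len set_ts by simp
qed

section \<open>Renaming vertices and comparing two forms\<close>

lemma arc_prod_map:
  assumes "inj_on f A" "set ts \<subseteq> arcs A" "x \<in> A"
  shows "arc_prod (map (map_prod f f) ts) (f x) = f (arc_prod ts x)"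
  using assms(2)
proof (induction ts rule: arc_prod.induct)
  case (2 a b ts)
  let ?y = "arc_prod ts x"
  have "?y \<in> A" "a \<in> A" "b \<in> A" using arc_prod_in[of ts A x] 2(2) assms(3) by (auto simp: arcs_def)
  then have "transpose (f a) (f b) (f ?y) = f (transpose a b ?y)"
    using assms(1) by (auto simp: transpose_def dest: inj_onD)
  then show ?case using 2 by simp
qed simp

lemma arc_gram_map:
  assumes "inj_on f A" "set ts \<subseteq> arcs A"
  shows "arc_gram (map (map_prod f f) ts) = arc_gram ts"
proof (rule eq_matI)
  fix i j assume "i < dim_row (arc_gram ts)" "j < dim_col (arc_gram ts)"
  then have ij: "i < length ts" "j < length ts" by simp_all
  then have "ts ! i \<in> arcs A" "ts ! j \<in> arcs A" using assms(2) by auto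
  then have "arc_inner (map_prod f f (ts ! i)) (map_prod f f (ts ! j)) = arc_inner (ts ! i) (ts ! j)"
    using assms(1) by (auto simp: arcs_def arc_inner_def arc_vec_def inj_on_eq_iff)
  then show "arc_gram (map (map_prod f f) ts) $$ (i, j) = arc_gram ts $$ (i, j)"
    using ij by (simp add: arc_gram_index)
qed simp_all

lemma arcs_connected_map:
  assumes f: "bij_betw f A A'" and ts: "set ts \<subseteq> arcs A" and conn: "arcs_connected A ts"
  shows "arcs_connected A' (map (map_prod f f) ts)"
  unfolding arcs_connected_def
proof (intro allI impI)
  fix C assume C: "C \<subseteq> A'" "\<forall>(a, b) \<in> set (map (map_prod f f) ts). a \<in> C \<longleftrightarrow> b \<in> C"
  let ?D = "{x \<in> A. f x \<in> C}"
  have "\<forall>(a, b) \<in> set ts. a \<in> ?D \<longleftrightarrow> b \<in> ?D" using C(2) ts by (fastforce simp: arcs_def)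
  moreover have "?D \<subseteq> A" by blast
  ultimately have "?D = {} \<or> ?D = A" using conn unfolding arcs_connected_def by blast
  moreover have "C = f ` ?D" using C(1) f unfolding bij_betw_def by blast
  ultimately show "C = {} \<or> C = A'" using f unfolding bij_betw_def by auto
qed

lemma arcs_map:
  assumes "bij_betw f A A'" "set ts \<subseteq> arcs A"
  shows "set (map (map_prod f f) ts) \<subseteq> arcs A'"
proof
  fix u assume "u \<in> set (map (map_prod f f) ts)"
  then obtain a b where "u = (f a, f b)" "(a, b) \<in> arcs A" using assms(2) by auto
  then show "u \<in> arcs A'"
    using assms(1) by (auto simp: arcs_def bij_betw_def dest: inj_onD)
qed

text \<open>Equal Coxeter polynomials make the two products conjugate. A conjugating bijection
  \<open>f\<close> renames vertices without changing the Gram matrix; then both lists factor the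
  same permutation and \<open>hurwitz_transitive\<close> applies.\<close>

lemma int_congruent_if_coxeter_eq:
  fixes N :: nat
  assumes ts: "set ts \<subseteq> arcs {..<N}" "arcs_connected {..<N} ts"
    and us: "set us \<subseteq> arcs {..<N}" "arcs_connected {..<N} us"
    and len: "length ts = length us"
    and cox: "char_poly (- (transpose_mat (arc_gram ts) * int_mat_inverse (arc_gram ts))) =
      char_poly (- (transpose_mat (arc_gram us) * int_mat_inverse (arc_gram us)))"
  shows "int_congruent (length ts) (arc_gram ts) (arc_gram us)"
proof -
  let ?s = "arc_prod ts" and ?t = "arc_prod us"
  \<comment> \<open>The common \<open>N\<close> and the equal lengths make the powers of
    \<open>x - 1\<close> agree, so they cancel.\<close>
  have "[:-1, 1:] ^ length ts * char_poly (map_to_mat N ?s :: int mat) =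
      [:-1, 1:] ^ length ts * char_poly (map_to_mat N ?t)"
    using coxeter_arc_gram[OF ts(1)] coxeter_arc_gram[OF us(1)] cox len by simp
  then have cp: "char_poly (map_to_mat N ?s :: int mat) = char_poly (map_to_mat N ?t)" by simp
  have img: "?s ` {..<N} \<subseteq> {..<N}" "?t ` {..<N} \<subseteq> {..<N}"
    using arc_prod_in[OF ts(1)] arc_prod_in[OF us(1)] by auto
  obtain f where f: "bij_betw f {..<N} {..<N}" "\<forall>z \<in> {..<N}. f (?s z) = ?t (f z)"
    using conjugate_if_fixpoint_counts[OF finite_lessThan finite_lessThan
        bij_is_inj[OF bij_arc_prod, of ts] bij_is_inj[OF bij_arc_prod, of us] img
        fixpoint_counts_if_char_poly_eq[OF img cp]] by metis
  let ?ts = "map (map_prod f f) ts"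
  have inj: "inj_on f {..<N}" using f(1) by (rule bij_betw_imp_inj_on)
  have ts': "set ?ts \<subseteq> arcs {..<N}" by (rule arcs_map[OF f(1) ts(1)])
  \<comment> \<open>Off \<open>{..<N}\<close> both products are the identity, so agreement on the
    vertices becomes equality of functions.\<close>
  have "arc_prod ?ts x = ?t x" for x
  proof (cases "x < N")
    case True
    then obtain z where "z < N" "x = f z" using f(1) unfolding bij_betw_def by blast
    then show ?thesis using f(2) arc_prod_map[OF inj ts(1), of z] by simp
  next
    case False
    then show ?thesis using arc_prod_fixes[OF ts'] arc_prod_fixes[OF us(1)] by simp
  qed
  then have "?ts \<simeq> us"
    using len by (intro hurwitz_transitive[OF finite_lessThan arcs_connected_map[OF f(1) ts] ts' us(2,1)]) auto
  moreover have "set ?ts \<subseteq> arcs UNIV" using ts' by (auto simp: arcs_def)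
  ultimately have "int_congruent (length ?ts) (arc_gram ?ts) (arc_gram us)"
    by (rule hurwitz_eq_int_congruent)
  then show ?thesis using arc_gram_map[OF inj ts(1)] by simp
qed

theorem theoremB:
  fixes n r :: nat and q q' :: "int vec \<Rightarrow> int"
  assumes "r \<ge> 1"
    and "unit_form n q" and "nonneg_form n q" and "connected_form n q"
    and "has_dynkin_type n q (Dyn_A r)"
    and "unit_form n q'" and "nonneg_form n q'" and "connected_form n q'"
    and "has_dynkin_type n q' (Dyn_A r)"
    and "weakly_gram_congruent n q q'"
  shows "strongly_gram_congruent n q q' \<longleftrightarrow> coxeter_poly n q = coxeter_poly n q'"
proof -
  obtain ts where ts: "length ts = n" "set ts \<subseteq> arcs {..<Suc r}" "arcs_connected {..<Suc r} ts"
    "upper_gram_mat n q = arc_gram ts"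
    using dynkin_A_arcs[OF assms(2,5)] .
  obtain us where us: "length us = n" "set us \<subseteq> arcs {..<Suc r}" "arcs_connected {..<Suc r} us"
    "upper_gram_mat n q' = arc_gram us"
    using dynkin_A_arcs[OF assms(6,9)] .
  have strong: "strongly_gram_congruent n q q' \<longleftrightarrow> int_congruent n (arc_gram ts) (arc_gram us)"
    by (simp add: strongly_gram_congruent_def int_congruent_def ts(4) us(4))
  have carrier: "arc_gram ts \<in> carrier_mat n n" "arc_gram us \<in> carrier_mat n n"
    using arc_gram_carrier[of ts] arc_gram_carrier[of us] ts(1) us(1) by simp_all
  \<comment> \<open>Strongly congruent forms have similar Coxeter matrices. Conversely, both lists
    have length \<open>n\<close> and live on the vertices \<open>{..<Suc r}\<close>, so equal
    polynomials yield a congruence.\<close>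
  show ?thesis
    unfolding strong coxeter_poly_def coxeter_mat_def ts(4) us(4)
    using similar_coxeter[OF carrier(1) det_arc_gram carrier(2) det_arc_gram]
      int_congruent_if_coxeter_eq[OF ts(2,3) us(2,3)] ts(1) us(1) by auto
qed

end
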